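(* Let $\mathbf{E} \in C^1((0,T); \mathbf{H}_{\#}(\mathbf{curl}; \Omega))$ and $\mathbf{K} \in C^1((0,T); \mathbf{H}_{\#}(\mathbf{curl};\Omega))$ be a solution of the system $$\partial_{tt} \mathbf{E} + c^2\, \mathbf{curl}\,\mathbf{curl}\, \mathbf{E} + \omega_{pe}^2 \mathbf{E} = -c^2\, \mathbf{curl}\, \mathbf{K}, \qquad \partial_{tt} \mathbf{K} + \omega_{pm}^2 \mathbf{K} = -\omega_{pm}^2\, \mathbf{curl}\, \mathbf{E}.$$ Then $$\frac{d\mathcal{E}_{EK}}{dt} = 0,$$ where $$\mathcal{E}_{EK} = \frac{1}{2}\Bigl( \frac{1}{c^2}\|\partial_t \mathbf{E}\|^2 + \frac{1}{\omega_{pm}^2}\|\partial_t \mathbf{K}\|^2 + \frac{\omega_{pe}^2}{c^2}\|\mathbf{E}\|^2 + \|\mathbf{curl}\, \mathbf{E} + \mathbf{K}\|^2 \Bigr).$$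
   Context: $\Omega = [0,L]^3$ is a cube, $T>0$. The constants $\varepsilon_0,\mu_0,\omega_{pe},\omega_{pm}$ are positive and $c = 1/\sqrt{\varepsilon_0\mu_0}$. $\|\cdot\|$ denotes the $L^2$ norm on $\Omega$. The function space is $$\mathbf{H}_{\#}(\mathbf{curl};\Omega) := \{\mathbf{v}\in (L^2(\Omega))^3 : \mathbf{curl}\,\mathbf{v}\in (L^2(\Omega))^3,\ \mathbf{v}\text{ periodic on }\partial\Omega\}.$$ The system is the second order formulation (for the electric field $\mathbf{E}$ and the magnetization current density $\mathbf{K}$) of Maxwell's equations in a Drude metamaterial. *)

theory Defs
  imports "HOL-Analysis.Analysis"
begin

type_synonym vfield = "real^3 \<Rightarrow> real^3"

definition cube :: "real \<Rightarrow> (real^3) set" where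
  "cube L = cbox 0 (\<chi> i. L)"

section \<open>Square-integrable fields\<close>

text \<open>Elements of $L^2(\Omega)^3$ are represented by functions on the whole space of which only the
  restriction to the cube matters; equality in $L^2$ is equality almost everywhere on the cube.\<close>

definition L2_field :: "real \<Rightarrow> vfield \<Rightarrow> bool" where
  "L2_field L v \<longleftrightarrow> v \<in> borel_measurable (lebesgue_on (cube L)) \<and>
     integrable (lebesgue_on (cube L)) (\<lambda>x. (norm (v x))\<^sup>2)"

definition L2_inner :: "real \<Rightarrow> vfield \<Rightarrow> vfield \<Rightarrow> real" where
  "L2_inner L u v = (LINT x|lebesgue_on (cube L). u x \<bullet> v x)"

definition L2_norm :: "real \<Rightarrow> vfield \<Rightarrow> real" where
  "L2_norm L v = sqrt (L2_inner L v v)"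

section \<open>Smooth fields and the classical curl\<close>

definition partial_deriv :: "3 \<Rightarrow> vfield \<Rightarrow> vfield" where
  "partial_deriv j f = (\<lambda>x. frechet_derivative f (at x) (axis j 1))"

primrec C_k :: "nat \<Rightarrow> vfield \<Rightarrow> bool" where
  "C_k 0 f \<longleftrightarrow> continuous_on UNIV f"
| "C_k (Suc k) f \<longleftrightarrow> (\<forall>x. f differentiable (at x)) \<and> (\<forall>j. C_k k (partial_deriv j f))"

definition smooth :: "vfield \<Rightarrow> bool" where
  "smooth f \<longleftrightarrow> (\<forall>k. C_k k f)"

definition classical_curl :: "vfield \<Rightarrow> vfield" where
  "classical_curl f = (\<lambda>x. vector
     [partial_deriv 2 f x $ 3 - partial_deriv 3 f x $ 2,
      partial_deriv 3 f x $ 1 - partial_deriv 1 f x $ 3,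
      partial_deriv 1 f x $ 2 - partial_deriv 2 f x $ 1])"

definition compact_tests :: "real \<Rightarrow> vfield set" where
  "compact_tests L = {\<phi>. smooth \<phi> \<and>
     (\<exists>S. compact S \<and> S \<subseteq> interior (cube L) \<and> (\<forall>x. x \<notin> S \<longrightarrow> \<phi> x = 0))}"

definition periodic_tests :: "real \<Rightarrow> vfield set" where
  "periodic_tests L = {\<phi>. smooth \<phi> \<and> (\<forall>x i. \<phi> (x + L *\<^sub>R axis i 1) = \<phi> x)}"

section \<open>The periodic space of square-integrable fields with square-integrable curl\<close>

definition has_weak_curl :: "real \<Rightarrow> vfield \<Rightarrow> vfield \<Rightarrow> bool" where
  "has_weak_curl L v w \<longleftrightarrow>
     (\<forall>\<phi>\<in>compact_tests L. L2_inner L w \<phi> = L2_inner L v (classical_curl \<phi>))"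

text \<open>The weak curl is determined only almost everywhere, so a representative is chosen.\<close>

definition curl :: "real \<Rightarrow> vfield \<Rightarrow> vfield" where
  "curl L v = (SOME w. L2_field L w \<and> has_weak_curl L v w)"

text \<open>A field in $H(\mathrm{curl};\Omega)$ has only a tangential trace $n \times v$ on the boundary, a
  functional given by Green's formula
  $\langle n \times v, \phi\rangle = \int_\Omega \mathrm{curl}\,v\cdot\phi - v\cdot\mathrm{curl}\,\phi$.
  The outer normals of opposite faces are opposite, so this trace takes the same values on opposite
  faces (as $v$ with a fixed normal) exactly when it vanishes on all periodic $\phi$.\<close>

definition tangential_trace :: "real \<Rightarrow> vfield \<Rightarrow> vfield \<Rightarrow> real" where
  "tangential_trace L v \<phi> = L2_inner L (curl L v) \<phi> - L2_inner L v (classical_curl \<phi>)"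

definition H_curl :: "real \<Rightarrow> vfield set" where
  "H_curl L = {v. L2_field L v \<and> (\<exists>w. L2_field L w \<and> has_weak_curl L v w)}"

definition H_curl_per :: "real \<Rightarrow> vfield set" where
  "H_curl_per L = {v \<in> H_curl L. \<forall>\<phi>\<in>periodic_tests L. tangential_trace L v \<phi> = 0}"

definition H_curl_norm :: "real \<Rightarrow> vfield \<Rightarrow> real" where
  "H_curl_norm L v = sqrt ((L2_norm L v)\<^sup>2 + (L2_norm L (curl L v))\<^sup>2)"

section \<open>Time-dependent fields\<close>

text \<open>\<open>u\<close> belongs to $C^1((0,T); H_\#(\mathrm{curl};\Omega))$ with time derivative \<open>ut\<close>, the limits
  being taken in the norm of that space.\<close>

definition C1_H_curl_per ::
    "real \<Rightarrow> real \<Rightarrow> (real \<Rightarrow> vfield) \<Rightarrow> (real \<Rightarrow> vfield) \<Rightarrow> bool" where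
  "C1_H_curl_per L T u ut \<longleftrightarrow>
     (\<forall>t\<in>{0<..<T}. u t \<in> H_curl_per L \<and> ut t \<in> H_curl_per L \<and>
        ((\<lambda>s. H_curl_norm L (\<lambda>x. (u s x - u t x) /\<^sub>R (s - t) - ut t x)) \<longlongrightarrow> 0) (at t) \<and>
        ((\<lambda>s. H_curl_norm L (\<lambda>x. ut s x - ut t x)) \<longlongrightarrow> 0) (at t))"

section \<open>The system in the sense of periodic distributions\<close>

text \<open>For $E \in C^1((0,T); H_\#(\mathrm{curl};\Omega))$ the terms $\partial_{tt}E$ and
  $\mathrm{curl}\,\mathrm{curl}\,E$ need not be functions. Both equations are read as identities
  between functionals on smooth periodic fields (vector distributions on the torus); since the curl
  is formally self-adjoint, the curl of such a functional is its composition with the curl.\<close>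

type_synonym vdistr = "vfield \<Rightarrow> real"

definition distr_of :: "real \<Rightarrow> vfield \<Rightarrow> vdistr" where
  "distr_of L v = (\<lambda>\<phi>. L2_inner L v \<phi>)"

definition distr_curl :: "vdistr \<Rightarrow> vdistr" where
  "distr_curl F = (\<lambda>\<phi>. F (classical_curl \<phi>))"

definition has_distr_derivative ::
    "real \<Rightarrow> (real \<Rightarrow> vdistr) \<Rightarrow> vdistr \<Rightarrow> real \<Rightarrow> bool" where
  "has_distr_derivative L F F' t \<longleftrightarrow>
     (\<forall>\<phi>\<in>periodic_tests L. ((\<lambda>s. F s \<phi>) has_real_derivative F' \<phi>) (at t))"

text \<open>\<open>Et\<close> and \<open>Kt\<close> are the time derivatives of \<open>E\<close> and \<open>K\<close>, and \<open>Ett\<close> and \<open>Ktt\<close> those of \<open>Et\<close> and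
  \<open>Kt\<close>.\<close>

definition EK_solution ::
    "real \<Rightarrow> real \<Rightarrow> real \<Rightarrow> real \<Rightarrow> real \<Rightarrow> (real \<Rightarrow> vfield) \<Rightarrow> (real \<Rightarrow> vfield) \<Rightarrow>
     (real \<Rightarrow> vfield) \<Rightarrow> (real \<Rightarrow> vfield) \<Rightarrow> bool" where
  "EK_solution L T c \<omega>pe \<omega>pm E Et K Kt \<longleftrightarrow>
     C1_H_curl_per L T E Et \<and> C1_H_curl_per L T K Kt \<and>
     (\<forall>t\<in>{0<..<T}. \<exists>Ett Ktt.
        has_distr_derivative L (\<lambda>s. distr_of L (Et s)) Ett t \<and>
        has_distr_derivative L (\<lambda>s. distr_of L (Kt s)) Ktt t \<and>
        (\<forall>\<phi>\<in>periodic_tests L.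
           Ett \<phi> + c\<^sup>2 * distr_curl (distr_curl (distr_of L (E t))) \<phi> + \<omega>pe\<^sup>2 * distr_of L (E t) \<phi>
             = - c\<^sup>2 * distr_curl (distr_of L (K t)) \<phi>) \<and>
        (\<forall>\<phi>\<in>periodic_tests L.
           Ktt \<phi> + \<omega>pm\<^sup>2 * distr_of L (K t) \<phi>
             = - \<omega>pm\<^sup>2 * distr_curl (distr_of L (E t)) \<phi>))"

definition energy_EK ::
    "real \<Rightarrow> real \<Rightarrow> real \<Rightarrow> real \<Rightarrow> (real \<Rightarrow> vfield) \<Rightarrow> (real \<Rightarrow> vfield) \<Rightarrow>
     (real \<Rightarrow> vfield) \<Rightarrow> (real \<Rightarrow> vfield) \<Rightarrow> real \<Rightarrow> real" where
  "energy_EK L c \<omega>pe \<omega>pm E Et K Kt t = 1/2 *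
     (1 / c\<^sup>2 * (L2_norm L (Et t))\<^sup>2
      + 1 / \<omega>pm\<^sup>2 * (L2_norm L (Kt t))\<^sup>2
      + \<omega>pe\<^sup>2 / c\<^sup>2 * (L2_norm L (E t))\<^sup>2
      + (L2_norm L (\<lambda>x. curl L (E t) x + K t x))\<^sup>2)"

end

(* For every wave vector k the cosine and sine coefficients of a field in H_#(curl) are
   transformed by the curl into those of the same k: periodic fields may be tested against the
   smooth periodic modes cos(k.x + alpha) a, and the curl of such a mode is the mode with phase
   alpha + pi/2 and amplitude k x a. So the weak system splits into one system of ordinary
   differential equations for each k, and each of these conserves its own quadratic energy.
   By Parseval's identity on L^2 of the cube the total energy is the sum of the mode energies,
   hence it is constant; the infinite sum itself never has to be differentiated. *)

theory Submission
  imports Defs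
begin

section \<open>Fourier modes on the cube\<close>

text \<open>The formal argument pairs the two equations with \<open>Et t\<close> and
  \<open>Kt t\<close>. A single mode is smooth and can serve as a test field. Because the fields are
  real, a complex Fourier coefficient is carried by two real phases, 0 and pi/2; a half turn of the
  phase is a change of sign, so these two suffice. The analytic core is the completeness of the
  waves, that is, equality in Bessel's inequality. Approximation in the L2 norm is enough for it, so
  nothing has to match on opposite faces of the cube, which are null sets. It suffices to
  approximate orthants, since they form an intersection-stable generator of the Borel sets. An
  orthant is a product of half spaces, and within one period a half space is a superlevel set of a
  shifted cosine.\<close>

definition freq :: "real \<Rightarrow> int^3 \<Rightarrow> real^3" where
  "freq L k = (\<chi> i. 2 * pi / L * of_int (k $ i))"

definition wave :: "real \<Rightarrow> int^3 \<Rightarrow> real^3 \<Rightarrow> complex" where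
  "wave L k x = cis (freq L k \<bullet> x)"

lemma freq_add: "freq L (k + l) = freq L k + freq L l"
  by (simp add: freq_def vec_eq_iff ring_distribs)

lemma freq_minus: "freq L (- k) = - freq L k"
  by (simp add: freq_def vec_eq_iff)

lemma freq_0 [simp]: "freq L 0 = 0"
  by (simp add: freq_def vec_eq_iff)

lemma wave_mult: "wave L k x * wave L l x = wave L (k + l) x"
  by (simp add: wave_def freq_add cis_mult inner_add_left)

lemma cnj_wave: "cnj (wave L k x) = wave L (- k) x"
  by (simp add: wave_def freq_minus cis_cnj)

lemma norm_wave [simp]: "norm (wave L k x) = 1"
  by (simp add: wave_def)

lemma wave_0 [simp]: "wave L 0 x = 1"
  by (simp add: wave_def)

lemma continuous_on_wave [continuous_intros]: "continuous_on S (wave L k)"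
  unfolding wave_def by (intro continuous_intros)

section \<open>Orthogonality of the waves over the cube\<close>

lemma integral_lborel_prod:
  fixes f :: "'a::euclidean_space \<Rightarrow> real \<Rightarrow> 'b::{real_normed_field,banach,second_countable_topology}"
  assumes "\<And>b. b \<in> Basis \<Longrightarrow> integrable lborel (f b)"
  shows "(LINT x|lborel. (\<Prod>b\<in>Basis. f b (x \<bullet> b))) = (\<Prod>b\<in>Basis. LINT x|lborel. f b x)"
proof -
  interpret product_sigma_finite "\<lambda>b::'a. lborel :: real measure" ..
  have [measurable]: "b \<in> Basis \<Longrightarrow> f b \<in> borel_measurable borel" for b
    using borel_measurable_integrable[OF assms] by simp
  \<comment> \<open>Lebesgue measure on a Euclidean space is the image of the product measure under
    the map that assembles a vector from its coordinates.\<close>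
  have "(LINT x|lborel. (\<Prod>b\<in>Basis. f b (x \<bullet> b)))
      = (LINT y|(\<Pi>\<^sub>M b\<in>Basis. lborel). (\<Prod>b\<in>Basis. f b ((\<Sum>c\<in>Basis. y c *\<^sub>R c) \<bullet> b)))"
    by (subst lborel_eq, subst integral_distr) auto
  also have "\<dots> = (LINT y|(\<Pi>\<^sub>M b\<in>Basis. lborel). (\<Prod>b\<in>Basis. f b (y b)))"
    by simp
  also have "\<dots> = (\<Prod>b\<in>Basis. LINT x|lborel. f b x)"
    by (rule product_integral_prod) (use assms in auto)
  finally show ?thesis .
qed

lemma integral_cis_period:
  assumes "L > 0"
  shows "(LINT x|lborel. indicator {0..L} x *\<^sub>R cis (2 * pi / L * of_int m * x)) = (if m = 0 then of_real L else 0)"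
proof (cases "m = 0")
  case True
  then show ?thesis using assms by (simp add: scaleR_conv_of_real)
next
  case False
  define a where "a = 2 * pi / L * of_int m"
  have a: "a \<noteq> 0" using False assms by (simp add: a_def)
  have "(LINT x|lborel. indicator {0..L} x *\<^sub>R cis (a * x)) = cis (a * L) / (\<i> * a) - cis (a * 0) / (\<i> * a)"
  proof (rule integral_FTC_Icc)
    show "((\<lambda>x. cis (a * x) / (\<i> * a)) has_vector_derivative cis (a * x)) (at x within {0..L})" for x
    proof -
      have "((\<lambda>z. exp (\<i> * a * z) / (\<i> * a)) has_field_derivative exp (\<i> * a * of_real x)) (at (of_real x))"
        using a by (auto intro!: derivative_eq_intros)
      from has_vector_derivative_real_field[OF this] show ?thesis
        by (simp add: cis_conv_exp mult.assoc)
    qed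
    show "continuous_on {0..L} (\<lambda>x. cis (a * x))" by (intro continuous_intros)
  qed (use assms in auto)
  \<comment> \<open>The argument is an integer multiple of 2 pi, so the antiderivative takes the
    same value at both ends.\<close>
  also have "cis (a * L) = 1"
  proof -
    have "a * L = 2 * pi * of_int m" using assms by (simp add: a_def)
    then show ?thesis by (simp add: cis_multiple_2pi mult.assoc[symmetric])
  qed
  finally show ?thesis using False by (simp add: a_def)
qed

lemma sets_cube [simp, measurable]: "cube L \<in> sets borel" "cube L \<in> sets lebesgue"
  by (simp_all add: cube_def)

lemma mem_cube: "x \<in> cube L \<longleftrightarrow> (\<forall>i. 0 \<le> x $ i \<and> x $ i \<le> L)"
  by (simp add: cube_def mem_box_cart)

lemma finite_measure_cube: "finite_measure (lebesgue_on (cube L))"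
  by (simp add: cube_def finite_measure_lebesgue_on)

lemma integral_lebesgue_on_cube:
  fixes f :: "real^3 \<Rightarrow> 'b::{banach, second_countable_topology}"
  assumes "f \<in> borel_measurable borel"
  shows "integral\<^sup>L (lebesgue_on (cube L)) f = (LINT x|lborel. indicator (cube L) x *\<^sub>R f x)"
  using assms by (subst integral_restrict_space) (auto intro!: integral_completion)

lemma prod_Basis_vec3: "(\<Prod>b\<in>(Basis::(real^3) set). f b) = (\<Prod>i\<in>UNIV. f (axis i 1))"
proof -
  have eq: "Basis = (\<lambda>i. axis i (1::real)) ` (UNIV :: 3 set)"
    by (auto simp: Basis_vec_def)
  show ?thesis
    unfolding eq by (subst prod.reindex) (auto simp: inj_on_def axis_eq_axis)
qed

text \<open>The indicator of the cube and the wave both factor over the coordinates, which leaves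
  three integrals over one period. Together with \<open>wave_mult\<close> this is the orthogonality
  of the waves.\<close>

lemma integral_wave:
  assumes "L > 0"
  shows "(LINT x|lebesgue_on (cube L). wave L k x) = (if k = 0 then of_real (L^3) else 0)"
proof -
  define f :: "real^3 \<Rightarrow> real \<Rightarrow> complex"
    where "f b y = indicator {0..L} y *\<^sub>R cis ((freq L k \<bullet> b) * y)" for b y
  have eq: "indicator (cube L) x *\<^sub>R wave L k x = (\<Prod>b\<in>Basis. f b (x \<bullet> b))" for x
  proof -
    have "(\<Prod>b\<in>Basis. f b (x \<bullet> b)) = (\<Prod>i\<in>UNIV. f (axis i 1) (x $ i))"
      by (simp add: prod_Basis_vec3 inner_axis)
    also have "\<dots> = (\<Prod>i\<in>UNIV. of_real (indicator {0..L} (x $ i))) * (\<Prod>i\<in>UNIV. cis (freq L k $ i * x $ i))"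
      by (simp add: f_def inner_axis scaleR_conv_of_real prod.distrib)
    also have "(\<Prod>i\<in>UNIV. of_real (indicator {0..L} (x $ i)) :: complex) = of_real (indicator (cube L) x)"
      by (auto simp: mem_cube indicator_def)
    also have "(\<Prod>i\<in>UNIV. cis (freq L k $ i * x $ i)) = wave L k x"
      by (simp add: wave_def inner_vec_def cis_conv_exp exp_sum[symmetric] sum_distrib_left)
    finally show ?thesis by (simp add: scaleR_conv_of_real)
  qed
  have "(LINT x|lebesgue_on (cube L). wave L k x) = (LINT x|lborel. indicator (cube L) x *\<^sub>R wave L k x)"
    by (intro integral_lebesgue_on_cube borel_measurable_continuous_onI continuous_intros)
  also have "\<dots> = (\<Prod>b\<in>Basis. LINT y|lborel. f b y)"
    unfolding eq
  proof (rule integral_lborel_prod)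
    fix b :: "real^3"
    show "integrable lborel (f b)"
      unfolding f_def
      by (rule borel_integrable_compact) (auto intro!: continuous_intros)
  qed
  also have "\<dots> = (\<Prod>i\<in>UNIV. if k $ i = 0 then of_real L else 0)"
    by (simp only: prod_Basis_vec3 f_def inner_axis freq_def vec_lambda_beta inner_real_def mult_1_right
        integral_cis_period[OF assms])
  also have "\<dots> = (if k = 0 then of_real (L^3) else 0)"
    by (auto simp: vec_eq_iff)
  finally show ?thesis .
qed

section \<open>Square-integrable functions on the cube\<close>

definition sq_integrable :: "real \<Rightarrow> (real^3 \<Rightarrow> 'b::euclidean_space) \<Rightarrow> bool" where
  "sq_integrable L f \<longleftrightarrow> f \<in> borel_measurable (lebesgue_on (cube L)) \<and>
     integrable (lebesgue_on (cube L)) (\<lambda>x. (norm (f x))\<^sup>2)"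

lemma sq_integrable_measurable [measurable_dest]:
  "sq_integrable L f \<Longrightarrow> f \<in> borel_measurable (lebesgue_on (cube L))"
  by (simp add: sq_integrable_def)

lemma sq_integrableD: "sq_integrable L f \<Longrightarrow> integrable (lebesgue_on (cube L)) (\<lambda>x. (norm (f x))\<^sup>2)"
  by (simp add: sq_integrable_def)

lemma norm_add_square_le:
  fixes a b :: "'a::real_normed_vector"
  shows "(norm (a + b))\<^sup>2 \<le> 2 * (norm a)\<^sup>2 + 2 * (norm b)\<^sup>2"
proof -
  have "(norm (a + b))\<^sup>2 \<le> (norm a + norm b)\<^sup>2"
    by (intro power_mono norm_triangle_ineq) auto
  also have "\<dots> \<le> 2 * (norm a)\<^sup>2 + 2 * (norm b)\<^sup>2"
    using sum_squares_bound[of "norm a" "norm b"] by (simp add: power2_eq_square algebra_simps)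
  finally show ?thesis .
qed

lemma sq_integrable_bound:
  fixes f :: "real^3 \<Rightarrow> 'b::euclidean_space"
  assumes "f \<in> borel_measurable (lebesgue_on (cube L))"
    and "integrable (lebesgue_on (cube L)) g" and "\<And>x. (norm (f x))\<^sup>2 \<le> g x"
  shows "sq_integrable L f"
  unfolding sq_integrable_def
proof
  show "integrable (lebesgue_on (cube L)) (\<lambda>x. (norm (f x))\<^sup>2)"
    by (rule Bochner_Integration.integrable_bound[OF assms(2)])
      (use assms in \<open>auto intro!: AE_I2 intro: order_trans[OF _ abs_ge_self]\<close>)
qed (fact assms)

lemma sq_integrable_add:
  fixes f g :: "real^3 \<Rightarrow> 'b::euclidean_space"
  assumes "sq_integrable L f" "sq_integrable L g"
  shows "sq_integrable L (\<lambda>x. f x + g x)"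
proof (rule sq_integrable_bound)
  show "(\<lambda>x. f x + g x) \<in> borel_measurable (lebesgue_on (cube L))"
    using assms by measurable
  show "integrable (lebesgue_on (cube L)) (\<lambda>x. 2 * (norm (f x))\<^sup>2 + 2 * (norm (g x))\<^sup>2)"
    using assms[THEN sq_integrableD] by simp
qed (rule norm_add_square_le)

lemma sq_integrable_scaleR:
  fixes f :: "real^3 \<Rightarrow> 'b::euclidean_space"
  assumes "sq_integrable L f"
  shows "sq_integrable L (\<lambda>x. c *\<^sub>R f x)"
  using assms by (auto simp: sq_integrable_def power_mult_distrib)

lemma sq_integrable_diff:
  fixes f g :: "real^3 \<Rightarrow> 'b::euclidean_space"
  assumes "sq_integrable L f" "sq_integrable L g"
  shows "sq_integrable L (\<lambda>x. f x - g x)"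
  using sq_integrable_add[OF assms(1) sq_integrable_scaleR[OF assms(2), of "-1"]] by simp

lemma sq_integrable_bounded:
  fixes f :: "real^3 \<Rightarrow> 'b::euclidean_space"
  assumes "f \<in> borel_measurable (lebesgue_on (cube L))" and "\<And>x. norm (f x) \<le> B"
  shows "sq_integrable L f"
proof (rule sq_integrable_bound[OF assms(1)])
  interpret finite_measure "lebesgue_on (cube L)" by (rule finite_measure_cube)
  show "integrable (lebesgue_on (cube L)) (\<lambda>x. B\<^sup>2)" by simp
  show "(norm (f x))\<^sup>2 \<le> B\<^sup>2" for x by (intro power_mono assms) auto
qed

lemma borel_measurable_lebesgue_on_cube:
  fixes f :: "real^3 \<Rightarrow> 'b::topological_space"
  shows "f \<in> borel_measurable borel \<Longrightarrow> f \<in> borel_measurable (lebesgue_on (cube L))"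
  by (simp add: measurable_completion measurable_restrict_space1)

lemma continuous_measurable_cube:
  fixes f :: "real^3 \<Rightarrow> 'b::topological_space"
  shows "continuous_on UNIV f \<Longrightarrow> f \<in> borel_measurable (lebesgue_on (cube L))"
  by (intro borel_measurable_lebesgue_on_cube borel_measurable_continuous_onI)

lemma wave_measurable [measurable]: "wave L k \<in> borel_measurable (lebesgue_on (cube L'))"
  by (intro continuous_measurable_cube continuous_intros)

lemma mult_le_sum_squares: "norm (a::'a::real_normed_vector) * norm (b::'b::real_normed_vector) \<le> (norm a)\<^sup>2 + (norm b)\<^sup>2"
proof -
  have "2 * (norm a * norm b) \<le> (norm a)\<^sup>2 + (norm b)\<^sup>2"
    using sum_squares_bound[of "norm a" "norm b"] by (simp add: mult.assoc)
  moreover have "0 \<le> norm a * norm b" by simp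
  ultimately show ?thesis by linarith
qed

lemma integrable_inner_sq_integrable:
  fixes f g :: "real^3 \<Rightarrow> 'b::euclidean_space"
  assumes "sq_integrable L f" "sq_integrable L g"
  shows "integrable (lebesgue_on (cube L)) (\<lambda>x. f x \<bullet> g x)"
proof (rule Bochner_Integration.integrable_bound)
  show "integrable (lebesgue_on (cube L)) (\<lambda>x. (norm (f x))\<^sup>2 + (norm (g x))\<^sup>2)"
    using assms by (auto dest: sq_integrableD)
  show "(\<lambda>x. f x \<bullet> g x) \<in> borel_measurable (lebesgue_on (cube L))"
    using assms by measurable
  show "AE x in lebesgue_on (cube L). norm (f x \<bullet> g x) \<le> norm ((norm (f x))\<^sup>2 + (norm (g x))\<^sup>2)"
    using order_trans[OF Cauchy_Schwarz_ineq2 mult_le_sum_squares] by (intro AE_I2) simp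
qed

lemma integrable_mult_sq_integrable:
  fixes f g :: "real^3 \<Rightarrow> complex"
  assumes "sq_integrable L f" "sq_integrable L g"
  shows "integrable (lebesgue_on (cube L)) (\<lambda>x. f x * g x)"
proof (rule Bochner_Integration.integrable_bound)
  show "integrable (lebesgue_on (cube L)) (\<lambda>x. (norm (f x))\<^sup>2 + (norm (g x))\<^sup>2)"
    using assms by (auto dest: sq_integrableD)
  show "(\<lambda>x. f x * g x) \<in> borel_measurable (lebesgue_on (cube L))"
    using assms by measurable
  show "AE x in lebesgue_on (cube L). norm (f x * g x) \<le> norm ((norm (f x))\<^sup>2 + (norm (g x))\<^sup>2)"
    using mult_le_sum_squares by (auto simp: norm_mult)
qed

lemma sq_integrable_wave: "sq_integrable L (\<lambda>x. a * wave L' k x)"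
  by (rule sq_integrable_bounded[where B = "norm a"]) (auto simp: norm_mult)

text \<open>Not normalised: the coefficient of the Fourier series is this integral divided by the
  volume \<open>L^3\<close>. The factor \<open>L^3\<close> in Parseval's identity comes from
  here.\<close>

definition fourier :: "real \<Rightarrow> (real^3 \<Rightarrow> complex) \<Rightarrow> int^3 \<Rightarrow> complex" where
  "fourier L f k = (LINT x|lebesgue_on (cube L). f x * wave L (- k) x)"

text \<open>By orthogonality, subtracting a multiple of one wave changes the coefficient at that
  frequency only. This lets a trigonometric polynomial be removed from \<open>f\<close> term by
  term.\<close>

lemma fourier_diff_wave:
  assumes "L > 0" "sq_integrable L f"
  shows "fourier L (\<lambda>x. f x - a * wave L k x) l = fourier L f l - (if k = l then a * of_real (L^3) else 0)"
proof -
  have "fourier L (\<lambda>x. f x - a * wave L k x) l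
      = (LINT x|lebesgue_on (cube L). f x * wave L (- l) x - a * wave L (k - l) x)"
    unfolding fourier_def by (simp add: left_diff_distrib mult.assoc wave_mult)
  also have "\<dots> = fourier L f l - a * (LINT x|lebesgue_on (cube L). wave L (k - l) x)"
    unfolding fourier_def
    using integrable_mult_sq_integrable[OF assms(2) sq_integrable_wave[of L 1]]
      integrable_mult_sq_integrable[OF sq_integrable_wave[of L 1] sq_integrable_wave[of L 1 L 0]]
    by (subst Bochner_Integration.integral_diff) auto
  finally show ?thesis using assms(1) by (auto simp: integral_wave)
qed

text \<open>The squared error is quadratic in \<open>a\<close>; completing the square shows the
  minimiser \<open>fourier L f k / L^3\<close> and the gain at the minimum.\<close>

lemma integral_cmod_diff_wave:
  assumes "L > 0" "sq_integrable L f"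
  shows "(LINT x|lebesgue_on (cube L). (cmod (f x - a * wave L k x))\<^sup>2)
    = (LINT x|lebesgue_on (cube L). (cmod (f x))\<^sup>2) - (cmod (fourier L f k))\<^sup>2 / L^3
      + L^3 * (cmod (a - fourier L f k / of_real (L^3)))\<^sup>2"
proof -
  interpret finite_measure "lebesgue_on (cube L)" by (rule finite_measure_cube)
  \<comment> \<open>The volume of the cube is the integral of the wave with frequency 0.\<close>
  have vol: "(LINT x|lebesgue_on (cube L). (1::real)) = L^3"
  proof -
    have "complex_of_real (LINT x|lebesgue_on (cube L). (1::real)) = of_real (L^3)"
      using integral_wave[OF assms(1), of 0] by (simp add: scaleR_conv_of_real)
    then show ?thesis by (simp only: of_real_eq_iff)
  qed
  have int: "integrable (lebesgue_on (cube L)) (\<lambda>x. f x * wave L (- k) x)"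
    using integrable_mult_sq_integrable[OF assms(2) sq_integrable_wave[of L 1]] by simp
  have eq: "(cmod (f x - a * wave L k x))\<^sup>2
    = (cmod (f x))\<^sup>2 - 2 * Re (cnj a * (f x * wave L (- k) x)) + (cmod a)\<^sup>2" for x
  proof -
    have "of_real ((cmod (f x - a * wave L k x))\<^sup>2)
        = of_real ((cmod (f x))\<^sup>2) - (cnj a * (f x * wave L (- k) x) + cnj (cnj a * (f x * wave L (- k) x)))
          + a * cnj a * (wave L k x * wave L (- k) x)"
      unfolding complex_norm_square by (simp add: cnj_wave algebra_simps)
    also have "wave L k x * wave L (- k) x = 1"
      by (simp add: wave_mult)
    also have "cnj a * (f x * wave L (- k) x) + cnj (cnj a * (f x * wave L (- k) x)) = of_real (2 * Re (cnj a * (f x * wave L (- k) x)))"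
      by (rule complex_add_cnj)
    finally have "of_real ((cmod (f x - a * wave L k x))\<^sup>2)
        = complex_of_real ((cmod (f x))\<^sup>2 - 2 * Re (cnj a * (f x * wave L (- k) x)) + (cmod a)\<^sup>2)"
      by (simp only: of_real_add of_real_diff complex_norm_square mult_1_right)
    then show ?thesis by (simp only: of_real_eq_iff)
  qed
  have "(LINT x|lebesgue_on (cube L). (cmod (f x - a * wave L k x))\<^sup>2)
      = (LINT x|lebesgue_on (cube L). (cmod (f x))\<^sup>2) - 2 * (LINT x|lebesgue_on (cube L). Re (cnj a * (f x * wave L (- k) x)))
        + (LINT x|lebesgue_on (cube L). (cmod a)\<^sup>2 * 1)"
  proof -
    define g where "g x = Re (cnj a * (f x * wave L (- k) x))" for x
    have "integrable (lebesgue_on (cube L)) g"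
      unfolding g_def using int by (intro integrable_Re integrable_mult_right)
    then show ?thesis
      unfolding eq g_def[symmetric] using sq_integrableD[OF assms(2)] by simp
  qed
  also have "(LINT x|lebesgue_on (cube L). Re (cnj a * (f x * wave L (- k) x))) = Re (cnj a * fourier L f k)"
    unfolding fourier_def using int
    by (subst integral_mult_right_zero[symmetric], subst integral_Re) auto
  also have "(LINT x|lebesgue_on (cube L). (cmod a)\<^sup>2 * 1) = (cmod a)\<^sup>2 * L^3"
    unfolding integral_mult_right_zero vol ..
  finally have *: "(LINT x|lebesgue_on (cube L). (cmod (f x - a * wave L k x))\<^sup>2)
      = (LINT x|lebesgue_on (cube L). (cmod (f x))\<^sup>2) - 2 * Re (cnj a * fourier L f k) + (cmod a)\<^sup>2 * L^3" .
  define V where "V = L^3"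
  have V: "V > 0" using assms(1) by (simp add: V_def)
  have "V * (cmod (a - c / of_real V))\<^sup>2 = V * (cmod a)\<^sup>2 - 2 * Re (cnj a * c) + (cmod c)\<^sup>2 / V" for c
    unfolding cmod_power2 using V by (simp add: field_simps power2_eq_square)
  then show ?thesis unfolding * V_def[symmetric] by (simp add: mult.commute)
qed

text \<open>Induction on the frequency set: the new wave is absorbed into \<open>f\<close>, whose
  other coefficients stay the same. The identity splits the error into the defect in Bessel's
  inequality and the distance of \<open>a\<close> from the optimal coefficients.\<close>

lemma integral_cmod_diff_trig_polynomial:
  assumes "L > 0" "finite F" "sq_integrable L f"
  shows "(LINT x|lebesgue_on (cube L). (cmod (f x - (\<Sum>k\<in>F. a k * wave L k x)))\<^sup>2)
    = (LINT x|lebesgue_on (cube L). (cmod (f x))\<^sup>2) - (\<Sum>k\<in>F. (cmod (fourier L f k))\<^sup>2) / L^3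
      + L^3 * (\<Sum>k\<in>F. (cmod (a k - fourier L f k / of_real (L^3)))\<^sup>2)"
  using assms(2,3)
proof (induction arbitrary: f)
  case (insert k F)
  let ?g = "\<lambda>x. f x - a k * wave L k x"
  have g: "sq_integrable L ?g"
    by (intro sq_integrable_diff sq_integrable_wave insert.prems)
  have c: "l \<in> F \<Longrightarrow> fourier L ?g l = fourier L f l" for l
    using insert.hyps by (auto simp: fourier_diff_wave[OF assms(1) insert.prems])
  have "(LINT x|lebesgue_on (cube L). (cmod (f x - (\<Sum>l\<in>insert k F. a l * wave L l x)))\<^sup>2)
      = (LINT x|lebesgue_on (cube L). (cmod (?g x - (\<Sum>l\<in>F. a l * wave L l x)))\<^sup>2)"
    using insert.hyps by (simp add: algebra_simps)
  also have "\<dots> = (LINT x|lebesgue_on (cube L). (cmod (?g x))\<^sup>2) - (\<Sum>k\<in>F. (cmod (fourier L f k))\<^sup>2) / L^3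
      + L^3 * (\<Sum>k\<in>F. (cmod (a k - fourier L f k / of_real (L^3)))\<^sup>2)"
    by (subst insert.IH[OF g]) (simp add: c)
  finally show ?case
    using insert.hyps by (simp add: integral_cmod_diff_wave[OF assms(1) insert.prems] algebra_simps add_divide_distrib)
qed simp

text \<open>The error identity is used in both directions: with the optimal coefficients it bounds
  the sum above by Bessel's inequality, with the coefficients of a good approximation it bounds the
  sum below.\<close>

lemma parseval_of_approximable:
  assumes "L > 0" and f: "sq_integrable L f"
    and approx: "\<And>e. e > 0 \<Longrightarrow> \<exists>F a. finite F \<and>
      (LINT x|lebesgue_on (cube L). (cmod (f x - (\<Sum>k\<in>F. a k * wave L k x)))\<^sup>2) < e"
  shows "((\<lambda>k. (cmod (fourier L f k))\<^sup>2) has_sum L^3 * (LINT x|lebesgue_on (cube L). (cmod (f x))\<^sup>2)) UNIV"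
proof -
  let ?I = "LINT x|lebesgue_on (cube L). (cmod (f x))\<^sup>2"
  let ?c = "\<lambda>k. (cmod (fourier L f k))\<^sup>2"
  have L3: "L^3 > 0" using assms(1) by simp
  have le: "sum ?c F \<le> L^3 * ?I" if "finite F" for F
  proof -
    let ?a = "\<lambda>k. fourier L f k / of_real (L^3)"
    have "0 \<le> (LINT x|lebesgue_on (cube L). (cmod (f x - (\<Sum>k\<in>F. ?a k * wave L k x)))\<^sup>2)"
      by simp
    then have "0 \<le> ?I - sum ?c F / L^3"
      unfolding integral_cmod_diff_trig_polynomial[OF assms(1) that f] by simp
    then show ?thesis using L3 by (simp add: field_simps)
  qed
  then have summable: "?c summable_on UNIV"
    by (intro nonneg_bdd_above_summable_on bdd_aboveI2) auto
  have "infsum ?c UNIV \<le> L^3 * ?I"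
    by (rule infsum_le_finite_sums[OF summable]) (use le in auto)
  moreover have "L^3 * ?I \<le> infsum ?c UNIV + e" if "e > 0" for e
  proof -
    from approx[of "e / L^3"] L3 that obtain F a where F: "finite F"
      "(LINT x|lebesgue_on (cube L). (cmod (f x - (\<Sum>k\<in>F. a k * wave L k x)))\<^sup>2) < e / L^3"
      by auto
    \<comment> \<open>The coefficients of the approximation need not be the optimal ones; their
      deviation only adds a nonnegative term, which is dropped.\<close>
    have "0 \<le> L^3 * (\<Sum>k\<in>F. (cmod (a k - fourier L f k / of_real (L^3)))\<^sup>2)"
      using L3 by (intro mult_nonneg_nonneg sum_nonneg) auto
    then have "?I - sum ?c F / L^3 < e / L^3"
      using F integral_cmod_diff_trig_polynomial[OF assms(1) F(1) f, of a] by linarith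
    then have "L^3 * ?I \<le> sum ?c F + e"
      using L3 by (simp add: field_simps)
    also have "sum ?c F \<le> infsum ?c UNIV"
      by (rule finite_sum_le_infsum[OF summable F(1)]) auto
    finally show ?thesis by simp
  qed
  ultimately have "infsum ?c UNIV = L^3 * ?I"
    by (meson antisym field_le_epsilon)
  with summable show ?thesis
    using has_sum_infsum by fastforce
qed

section \<open>Density of trigonometric polynomials\<close>

text \<open>Generated by single waves and sums, so that closure properties are plain inductions; the
  normal form with distinct frequencies is recovered in \<open>trig_poly_eq_sum\<close>.\<close>

inductive trig_poly :: "real \<Rightarrow> (real^3 \<Rightarrow> complex) \<Rightarrow> bool" for L where
  wave: "trig_poly L (\<lambda>x. a * wave L k x)"
| add: "trig_poly L p \<Longrightarrow> trig_poly L q \<Longrightarrow> trig_poly L (\<lambda>x. p x + q x)"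

lemma trig_poly_const: "trig_poly L (\<lambda>x. c)"
  using trig_poly.wave[of L c 0] by simp

lemma trig_poly_mult:
  assumes "trig_poly L p" "trig_poly L q"
  shows "trig_poly L (\<lambda>x. p x * q x)"
  using assms(1)
proof induction
  case (wave a k)
  from assms(2) show ?case
  proof induction
    case (wave b l)
    have "trig_poly L (\<lambda>x. a * b * wave L (k + l) x)" by (rule trig_poly.wave)
    then show ?case by (simp add: wave_mult[symmetric] mult_ac)
  next
    case (add q r)
    from trig_poly.add[OF add.IH] show ?case by (simp add: algebra_simps)
  qed
next
  case (add p r)
  from trig_poly.add[OF add.IH] show ?case by (simp add: algebra_simps)
qed

lemma trig_poly_prod:
  assumes "finite I" "\<And>i. i \<in> I \<Longrightarrow> trig_poly L (p i)"
  shows "trig_poly L (\<lambda>x. \<Prod>i\<in>I. p i x)"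
  using assms by (induction I) (auto intro: trig_poly_const trig_poly_mult)

lemma trig_poly_eq_sum:
  assumes "trig_poly L p"
  shows "\<exists>F a. finite F \<and> p = (\<lambda>x. \<Sum>k\<in>F. a k * wave L k x)"
  using assms
proof induction
  case (wave a k)
  show ?case by (rule exI[of _ "{k}"], rule exI[of _ "\<lambda>_. a"]) simp
next
  case (add p q)
  then obtain F a G b where F: "finite F" "p = (\<lambda>x. \<Sum>k\<in>F. a k * wave L k x)"
    and G: "finite G" "q = (\<lambda>x. \<Sum>k\<in>G. b k * wave L k x)"
    by blast
  \<comment> \<open>The two frequency sets may overlap, so both coefficient families are extended by
    0 and added on the union.\<close>
  define c where "c k = (if k \<in> F then a k else 0) + (if k \<in> G then b k else 0)" for k
  have "p x + q x = (\<Sum>k\<in>F \<union> G. c k * wave L k x)" for x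
  proof -
    have "p x = (\<Sum>k\<in>F \<union> G. (if k \<in> F then a k else 0) * wave L k x)"
      unfolding F(2) by (rule sum.mono_neutral_cong_left) (use F G in auto)
    moreover have "q x = (\<Sum>k\<in>F \<union> G. (if k \<in> G then b k else 0) * wave L k x)"
      unfolding G(2) by (rule sum.mono_neutral_cong_left) (use F G in auto)
    ultimately show ?thesis
      by (simp only: c_def distrib_right sum.distrib)
  qed
  with F(1) G(1) show ?case by (intro exI[of _ "F \<union> G"] exI[of _ c]) auto
qed

lemma trig_poly_continuous: "trig_poly L p \<Longrightarrow> continuous_on UNIV p"
  by (induction rule: trig_poly.induct) (auto intro!: continuous_intros)

lemma trig_poly_bounded: "trig_poly L p \<Longrightarrow> \<exists>B. \<forall>x. cmod (p x) \<le> B"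
proof (induction rule: trig_poly.induct)
  case (wave a k)
  show ?case by (rule exI[of _ "cmod a"]) (simp add: norm_mult)
next
  case (add p q)
  then show ?case by (meson add_mono norm_triangle_ineq order_trans)
qed

lemma trig_poly_sq_integrable: "trig_poly L p \<Longrightarrow> sq_integrable L p"
  using trig_poly_bounded sq_integrable_bounded continuous_measurable_cube trig_poly_continuous by metis

text \<open>Euler's formula; the shift \<open>m\<close> goes into the coefficients of the two waves
  with frequencies \<open>axis i 1\<close> and \<open>- axis i 1\<close>.\<close>

lemma trig_poly_cos: "trig_poly L (\<lambda>x. of_real (cos (2 * pi / L * x $ i - m)))"
proof -
  have "of_real (cos (2 * pi / L * x $ i - m))
      = cis (- m) / 2 * wave L (axis i 1) x + cis m / 2 * wave L (- axis i 1) x" for x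
  proof -
    have "freq L (axis i 1) \<bullet> x = 2 * pi / L * x $ i"
      by (simp add: freq_def axis_def inner_vec_def if_distrib if_distribR cong: if_cong)
    then show ?thesis
      by (simp add: wave_def freq_minus cos_diff complex_eq_iff diff_divide_distrib mult_ac)
  qed
  then show ?thesis
    by (simp only: trig_poly.intros)
qed

text \<open>Trigonometric polynomials form an algebra with constants. The Weierstrass approximants
  can therefore be composed with a shifted cosine.\<close>

lemma trig_poly_real_polynomial:
  fixes q :: "real \<Rightarrow> real"
  assumes "real_polynomial_function q" "trig_poly L (\<lambda>x. of_real (f x))"
  shows "trig_poly L (\<lambda>x. of_real (q (f x)))"
  using assms(1)
proof induction
  case (linear q)
  then obtain c where "q = (\<lambda>x. x * c)" by (auto simp: real_bounded_linear)
  with trig_poly_mult[OF assms(2) trig_poly_const[of L "of_real c"]] show ?case by simp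
next
  case (const c)
  show ?case by (rule trig_poly_const)
next
  case (add q r)
  from trig_poly.add[OF add.IH] show ?case by simp
next
  case (mult q r)
  from trig_poly_mult[OF mult.IH] show ?case by simp
qed

text \<open>On one period the interval \<open>(0, a)\<close> is the set where \<open>cos (2\<pi>x/L - h) > cos h\<close> with
  \<open>h = \<pi>a/L\<close>, and Weierstrass' theorem approximates a step function of that cosine by
  polynomials in it.\<close>

lemma trig_poly_half_space:
  assumes "L > 0"
  shows "\<exists>p. (\<forall>n. trig_poly L (p n)) \<and> (\<forall>n x. cmod (p n x) \<le> 2) \<and>
    (\<forall>x. 0 < x $ i \<longrightarrow> x $ i < L \<longrightarrow> x $ i \<noteq> a \<longrightarrow>
      (\<lambda>n. p n x) \<longlonglongrightarrow> (if x $ i \<le> a then 1 else 0))"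
proof -
  consider "a \<le> 0" | "a \<ge> L" | "0 < a" "a < L" by linarith
  then show ?thesis
  proof cases
    \<comment> \<open>For \<open>a\<close> outside the open period the half space misses or contains
      all relevant points, and a constant sequence serves.\<close>
    case 1
    then show ?thesis by (intro exI[of _ "\<lambda>_ _. 0"]) (auto intro: trig_poly_const)
  next
    case 2
    then show ?thesis by (intro exI[of _ "\<lambda>_ _. 1"]) (auto intro: trig_poly_const)
  next
    case 3
    define h where "h = pi * a / L"
    have h: "0 < h" "h < pi" using 3 assms by (auto simp: h_def field_simps)
    \<comment> \<open>Ramps of slope \<open>n\<close> starting at \<open>cos h\<close>: continuous,
      with values in [0, 1], and tending pointwise to the step function that jumps just after
      \<open>cos h\<close>.\<close>
    define u where "u n y = min 1 (real n * max 0 (y - cos h))" for n y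
    have u: "0 \<le> u n y" "u n y \<le> 1" for n y
      by (auto simp: u_def)
    \<comment> \<open>The error \<open>1 / real (Suc n)\<close> tends to 0, as the limit requires,
      and is at most 1, which gives the bound 2 for the polynomials.\<close>
    have "\<exists>q. real_polynomial_function q \<and> (\<forall>y\<in>{-1..1}. \<bar>u n y - q y\<bar> < 1 / real (Suc n))" for n
      by (rule Stone_Weierstrass_real_polynomial_function[of "{-1..1}" "u n" "1 / real (Suc n)"])
        (auto simp: u_def intro!: continuous_intros)
    then obtain q where q: "\<And>n. real_polynomial_function (q n)"
      "\<And>n y. y \<in> {-1..1} \<Longrightarrow> \<bar>u n y - q n y\<bar> < 1 / real (Suc n)"
      by metis
    define g where "g x = cos (2 * pi / L * x $ i - h)" for x :: "real^3"
    have g: "g x \<in> {-1..1}" for x by (simp add: g_def)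
    have lim_u: "(\<lambda>n. u n y) \<longlonglongrightarrow> (if y > cos h then 1 else 0)" for y
    proof (cases "y > cos h")
      case True
      obtain N where N: "real N > 1 / (y - cos h)" using reals_Archimedean2 by blast
      have "u n y = 1" if "n \<ge> N" for n
      proof -
        have "1 \<le> real N * (y - cos h)" using N True by (simp add: field_simps)
        also have "\<dots> \<le> real n * (y - cos h)" using that True by (intro mult_right_mono) auto
        finally show ?thesis using True by (simp add: u_def)
      qed
      then have "\<forall>\<^sub>F n in sequentially. u n y = 1" by (auto simp: eventually_sequentially)
      with True show ?thesis by (simp add: tendsto_eventually)
    next
      case False
      then show ?thesis by (simp add: u_def)
    qed
    have lim_q: "(\<lambda>n. q n y) \<longlonglongrightarrow> (if y > cos h then 1 else 0)" if "y \<in> {-1..1}" for y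
    proof -
      have "(\<lambda>n. u n y - q n y) \<longlonglongrightarrow> 0"
        by (rule Lim_null_comparison[OF _ LIMSEQ_Suc[OF lim_1_over_n]])
          (use q(2)[OF that] in \<open>auto intro!: always_eventually less_imp_le\<close>)
      from tendsto_diff[OF lim_u[of y] this] show ?thesis by (simp only: diff_diff_eq2 add_diff_cancel_left' diff_zero)
    qed
    \<comment> \<open>The argument \<theta> runs through the full period from -h to 2 pi - h, on
      which the cosine exceeds \<open>cos h\<close> exactly between -h and h.\<close>
    have sign: "g x > cos h \<longleftrightarrow> x $ i \<le> a" if x: "0 < x $ i" "x $ i < L" "x $ i \<noteq> a" for x
    proof -
      define \<theta> where "\<theta> = 2 * pi / L * x $ i - h"
      have \<theta>: "- h < \<theta>" "\<theta> < 2 * pi - h" "\<theta> < h \<longleftrightarrow> x $ i < a" "\<theta> > h \<longleftrightarrow> x $ i > a"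
      proof -
        define s where "s = pi / L"
        have s: "s > 0" using assms by (simp add: s_def)
        have eq: "\<theta> = 2 * (s * x $ i) - h" "h = s * a" "pi = s * L"
          using assms by (simp_all add: \<theta>_def h_def s_def)
        have "0 < s * x $ i" "s * x $ i < s * L" "s * x $ i < s * a \<longleftrightarrow> x $ i < a" "s * a < s * x $ i \<longleftrightarrow> a < x $ i"
          using x s by simp_all
        then show "- h < \<theta>" "\<theta> < 2 * pi - h" "\<theta> < h \<longleftrightarrow> x $ i < a" "\<theta> > h \<longleftrightarrow> x $ i > a"
          unfolding eq(1) eq(2) eq(3) by linarith+
      qed
      show ?thesis
      proof (cases "x $ i < a")
        case True
        then have "cos h < cos \<bar>\<theta>\<bar>" using \<theta> h by (intro cos_monotone_0_pi) auto
        then show ?thesis using True by (simp add: g_def \<theta>_def)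
      next
        case False
        then have gt: "\<theta> > h" using x \<theta> by auto
        have "cos \<theta> < cos h"
        proof (cases "\<theta> \<le> pi")
          case True
          then show ?thesis using gt h by (intro cos_monotone_0_pi) auto
        next
          case False
          \<comment> \<open>Beyond pi the argument is reflected into the interval from h to pi,
            where the cosine decreases.\<close>
          have "cos (2 * pi - \<theta>) < cos h"
            using False \<theta> h by (intro cos_monotone_0_pi) auto
          then show ?thesis by (simp add: cos_diff)
        qed
        then show ?thesis using False x by (simp add: g_def \<theta>_def)
      qed
    qed
    show ?thesis
    proof (intro exI[of _ "\<lambda>n x. complex_of_real (q n (g x))"] conjI allI impI)
      show "trig_poly L (\<lambda>x. complex_of_real (q n (g x)))" for n
        unfolding g_def by (rule trig_poly_real_polynomial[OF q(1) trig_poly_cos])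
      show "cmod (complex_of_real (q n (g x))) \<le> 2" for n x
      proof -
        have "1 / real (Suc n) \<le> 1" by simp
        then show ?thesis using q(2)[OF g, of n x] u[of n "g x"] unfolding norm_of_real by linarith
      qed
      show "(\<lambda>n. complex_of_real (q n (g x))) \<longlonglongrightarrow> (if x $ i \<le> a then 1 else 0)"
        if "0 < x $ i" "x $ i < L" "x $ i \<noteq> a" for x
        using tendsto_of_real[OF lim_q[OF g[of x]], where ?'a = complex] sign[OF that]
        by (simp split: if_splits)
    qed
  qed
qed

section \<open>Real functions in the L2 closure of the trigonometric polynomials\<close>

definition approximable :: "real \<Rightarrow> (real^3 \<Rightarrow> real) \<Rightarrow> bool" where
  "approximable L f \<longleftrightarrow> sq_integrable L f \<and>
     (\<forall>e>0. \<exists>p. trig_poly L p \<and> (LINT x|lebesgue_on (cube L). (cmod (of_real (f x) - p x))\<^sup>2) < e)"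

lemma sq_integrable_of_real: "sq_integrable L f \<Longrightarrow> sq_integrable L (\<lambda>x. complex_of_real (f x))"
  unfolding sq_integrable_def norm_of_real real_norm_def[symmetric]
  by (elim conjE, intro conjI) (rule measurable_compose[OF _ borel_measurable_of_real], assumption+)

lemma integral_norm_add_square_le:
  fixes f g :: "real^3 \<Rightarrow> 'b::euclidean_space"
  assumes "sq_integrable L f" "sq_integrable L g"
  shows "(LINT x|lebesgue_on (cube L). (norm (f x + g x))\<^sup>2)
    \<le> 2 * (LINT x|lebesgue_on (cube L). (norm (f x))\<^sup>2) + 2 * (LINT x|lebesgue_on (cube L). (norm (g x))\<^sup>2)"
proof -
  note int = assms[THEN sq_integrableD]
  have "(LINT x|lebesgue_on (cube L). (norm (f x + g x))\<^sup>2)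
      \<le> (LINT x|lebesgue_on (cube L). 2 * (norm (f x))\<^sup>2 + 2 * (norm (g x))\<^sup>2)"
    using int sq_integrableD[OF sq_integrable_add[OF assms]]
    by (intro integral_mono norm_add_square_le) auto
  then show ?thesis using int by simp
qed

text \<open>Approximable functions form a closed set in L2. The tolerance \<open>e / 4\<close>
  compensates for the factor 2 that each part receives in the square of a sum.\<close>

lemma approximable_trans:
  assumes f: "sq_integrable L f"
    and "\<And>e. e > 0 \<Longrightarrow> \<exists>g. approximable L g \<and> (LINT x|lebesgue_on (cube L). (f x - g x)\<^sup>2) < e"
  shows "approximable L f"
  unfolding approximable_def
proof (intro conjI allI impI f)
  fix e :: real assume "e > 0"
  then obtain g where g: "approximable L g" "(LINT x|lebesgue_on (cube L). (f x - g x)\<^sup>2) < e / 4"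
    using assms(2)[of "e / 4"] by auto
  have sg: "sq_integrable L g" using g by (simp add: approximable_def)
  obtain p where p: "trig_poly L p" "(LINT x|lebesgue_on (cube L). (cmod (of_real (g x) - p x))\<^sup>2) < e / 4"
    using g(1) \<open>e > 0\<close> unfolding approximable_def by (meson divide_pos_pos zero_less_numeral)
  have "(LINT x|lebesgue_on (cube L). (cmod (of_real (f x) - p x))\<^sup>2)
      = (LINT x|lebesgue_on (cube L). (cmod (of_real (f x - g x) + (of_real (g x) - p x)))\<^sup>2)"
    by simp
  also have "\<dots> \<le> 2 * (LINT x|lebesgue_on (cube L). (cmod (of_real (f x - g x)))\<^sup>2)
      + 2 * (LINT x|lebesgue_on (cube L). (cmod (of_real (g x) - p x))\<^sup>2)"
    by (intro integral_norm_add_square_le sq_integrable_of_real sq_integrable_diff f sg trig_poly_sq_integrable p)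
  also have "\<dots> < e" using g p by (simp del: of_real_diff)
  finally show "\<exists>p. trig_poly L p \<and> (LINT x|lebesgue_on (cube L). (cmod (of_real (f x) - p x))\<^sup>2) < e"
    using p by blast
qed

lemma approximable_add:
  assumes "approximable L f" "approximable L g"
  shows "approximable L (\<lambda>x. f x + g x)"
  unfolding approximable_def
proof (intro conjI allI impI)
  have sq: "sq_integrable L f" "sq_integrable L g" using assms by (auto simp: approximable_def)
  then show "sq_integrable L (\<lambda>x. f x + g x)" by (rule sq_integrable_add)
  fix e :: real assume "e > 0"
  then have "e / 4 > 0" by simp
  with assms obtain p q where p: "trig_poly L p" "(LINT x|lebesgue_on (cube L). (cmod (of_real (f x) - p x))\<^sup>2) < e / 4"
    and q: "trig_poly L q" "(LINT x|lebesgue_on (cube L). (cmod (of_real (g x) - q x))\<^sup>2) < e / 4"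
    unfolding approximable_def by meson
  have "(LINT x|lebesgue_on (cube L). (cmod (of_real (f x + g x) - (p x + q x)))\<^sup>2)
      = (LINT x|lebesgue_on (cube L). (cmod ((of_real (f x) - p x) + (of_real (g x) - q x)))\<^sup>2)"
    by (simp add: algebra_simps)
  also have "\<dots> \<le> 2 * (LINT x|lebesgue_on (cube L). (cmod (of_real (f x) - p x))\<^sup>2)
      + 2 * (LINT x|lebesgue_on (cube L). (cmod (of_real (g x) - q x))\<^sup>2)"
    by (intro integral_norm_add_square_le sq_integrable_of_real sq_integrable_diff sq trig_poly_sq_integrable p q)
  also have "\<dots> < e" using p q by simp
  finally show "\<exists>p. trig_poly L p \<and> (LINT x|lebesgue_on (cube L). (cmod (of_real (f x + g x) - p x))\<^sup>2) < e"
    using trig_poly.add[OF p(1) q(1)] by blast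
qed

lemma approximable_const: "approximable L (\<lambda>x. c)"
  unfolding approximable_def
  by (auto intro!: sq_integrable_bounded[where B = "\<bar>c\<bar>"] exI[of _ "\<lambda>x. of_real c"] trig_poly_const)

lemma approximable_scale:
  assumes "approximable L f"
  shows "approximable L (\<lambda>x. c * f x)"
proof (cases "c = 0")
  case True
  then show ?thesis using approximable_const[of L 0] by simp
next
  case False
  show ?thesis
    unfolding approximable_def
  proof (intro conjI allI impI)
    show "sq_integrable L (\<lambda>x. c * f x)"
      using sq_integrable_scaleR[of L f c] assms by (simp add: approximable_def)
    fix e :: real assume "e > 0"
    then obtain p where p: "trig_poly L p" "(LINT x|lebesgue_on (cube L). (cmod (of_real (f x) - p x))\<^sup>2) < e / c\<^sup>2"
      using assms False unfolding approximable_def by (meson divide_pos_pos zero_less_power2)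
    have "(LINT x|lebesgue_on (cube L). (cmod (of_real (c * f x) - of_real c * p x))\<^sup>2)
        = c\<^sup>2 * (LINT x|lebesgue_on (cube L). (cmod (of_real (f x) - p x))\<^sup>2)"
      by (simp add: norm_mult power_mult_distrib flip: right_diff_distrib)
    also have "\<dots> < e" using p False by (simp add: field_simps)
    finally show "\<exists>p. trig_poly L p \<and> (LINT x|lebesgue_on (cube L). (cmod (of_real (c * f x) - p x))\<^sup>2) < e"
      using trig_poly_mult[OF trig_poly_const p(1)] by blast
  qed
qed

lemma approximable_diff:
  assumes "approximable L f" "approximable L g"
  shows "approximable L (\<lambda>x. f x - g x)"
  using approximable_add[OF assms(1) approximable_scale[OF assms(2), of "-1"]] by simp

text \<open>Dominated convergence with the square of \<open>f\<close> as majorant. The bound on the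
  error is the one satisfied by nonnegative sequences increasing to \<open>f\<close>, and only these
  occur below.\<close>

lemma approximable_dominated_limit:
  assumes "\<And>n. approximable L (g n)" and f: "sq_integrable L f"
    and lim: "\<And>x. (\<lambda>n. g n x) \<longlonglongrightarrow> f x" and bound: "\<And>n x. \<bar>f x - g n x\<bar> \<le> \<bar>f x\<bar>"
  shows "approximable L f"
proof (rule approximable_trans[OF f])
  fix e :: real assume "e > 0"
  have sg: "sq_integrable L (g n)" for n using assms(1) by (simp add: approximable_def)
  have "(\<lambda>n. LINT x|lebesgue_on (cube L). (f x - g n x)\<^sup>2) \<longlonglongrightarrow> (LINT x|lebesgue_on (cube L). (0::real))"
  proof (rule integral_dominated_convergence[where w = "\<lambda>x. (f x)\<^sup>2"])
    show "integrable (lebesgue_on (cube L)) (\<lambda>x. (f x)\<^sup>2)" using sq_integrableD[OF f] by simp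
    show "(\<lambda>x. (f x - g n x)\<^sup>2) \<in> borel_measurable (lebesgue_on (cube L))" for n
      using f sg[of n] by measurable
    show "AE x in lebesgue_on (cube L). (\<lambda>n. (f x - g n x)\<^sup>2) \<longlonglongrightarrow> 0"
    proof (rule AE_I2)
      fix x
      have "(\<lambda>n. (f x - g n x)\<^sup>2) \<longlonglongrightarrow> (f x - f x)\<^sup>2"
        by (intro tendsto_intros lim)
      then show "(\<lambda>n. (f x - g n x)\<^sup>2) \<longlonglongrightarrow> 0" by simp
    qed
    show "AE x in lebesgue_on (cube L). norm ((f x - g n x)\<^sup>2) \<le> (f x)\<^sup>2" for n
      using bound by (intro AE_I2) (simp add: abs_le_square_iff)
  qed simp
  then have "\<forall>\<^sub>F n in sequentially. (LINT x|lebesgue_on (cube L). (f x - g n x)\<^sup>2) < e"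
    using \<open>e > 0\<close> by (intro order_tendstoD(2)) auto
  then show "\<exists>g. approximable L g \<and> (LINT x|lebesgue_on (cube L). (f x - g x)\<^sup>2) < e"
    using assms(1) eventually_happens trivial_limit_sequentially by blast
qed

text \<open>Discards the faces of the cube and the bounding hyperplanes of an orthant, where the
  approximants of a half space are not controlled.\<close>

lemma AE_cube_nth_neq: "AE x in lebesgue_on (cube L). x $ i \<noteq> c"
proof -
  have "negligible {x::real^3. x $ i = c}" unfolding cart_eq_inner_axis by (rule negligible_standard_hyperplane) simp
  then have "AE x in lebesgue. x $ i \<noteq> c"
    by (intro AE_I'[where N = "{x::real^3. x $ i = c}"]) (auto simp: negligible_iff_null_sets)
  then show ?thesis by (subst AE_restrict_space_iff) auto
qed

text \<open>The indicator of an orthant is the product of three half-space indicators, and so is its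
  approximation. Three factors bounded by 2 give the bound 8, and subtracting from an indicator
  gives the dominating constant 9.\<close>

lemma approximable_orthant:
  fixes a :: "real^3"
  assumes "L > 0"
  shows "approximable L (indicator {..a})"
proof -
  have "\<forall>i. \<exists>p. (\<forall>n. trig_poly L (p n)) \<and> (\<forall>n x. cmod (p n x) \<le> 2) \<and>
    (\<forall>x. 0 < x $ i \<longrightarrow> x $ i < L \<longrightarrow> x $ i \<noteq> a $ i \<longrightarrow>
      (\<lambda>n. p n x) \<longlonglongrightarrow> (if x $ i \<le> a $ i then 1 else 0))"
    using trig_poly_half_space[OF assms] by blast
  then obtain p where p: "\<And>i n. trig_poly L (p i n)" "\<And>i n x. cmod (p i n x) \<le> 2"
    "\<And>i x. 0 < x $ i \<Longrightarrow> x $ i < L \<Longrightarrow> x $ i \<noteq> a $ i \<Longrightarrow> (\<lambda>n. p i n x) \<longlonglongrightarrow> (if x $ i \<le> a $ i then 1 else 0)"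
    by metis
  define s where "s n x = (\<Prod>i\<in>UNIV. p i n x)" for n x
  have s: "trig_poly L (s n)" for n
    unfolding s_def by (intro trig_poly_prod p) auto
  have bound: "cmod (s n x) \<le> 8" for n x
  proof -
    have "(\<Prod>i\<in>UNIV. cmod (p i n x)) \<le> (\<Prod>i\<in>(UNIV::3 set). 2)"
      by (intro prod_mono) (auto intro: p)
    then show ?thesis by (simp add: s_def prod_norm)
  qed
  let ?f = "indicator {..a} :: real^3 \<Rightarrow> real"
  have f: "sq_integrable L ?f"
    by (rule sq_integrable_bounded[where B = 1]) (auto simp: indicator_def intro!: borel_measurable_lebesgue_on_cube)
  have "(\<lambda>n. LINT x|lebesgue_on (cube L). (cmod (of_real (?f x) - s n x))\<^sup>2) \<longlonglongrightarrow> (LINT x|lebesgue_on (cube L). (0::real))"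
  proof (rule integral_dominated_convergence[where w = "\<lambda>x. 9\<^sup>2"])
    interpret finite_measure "lebesgue_on (cube L)" by (rule finite_measure_cube)
    show "integrable (lebesgue_on (cube L)) (\<lambda>x. 9\<^sup>2 :: real)" by simp
    show "(\<lambda>x. (cmod (of_real (?f x) - s n x))\<^sup>2) \<in> borel_measurable (lebesgue_on (cube L))" for n
      using sq_integrable_of_real[OF f] trig_poly_sq_integrable[OF s, of n] by measurable
    show "AE x in lebesgue_on (cube L). norm ((cmod (of_real (?f x) - s n x))\<^sup>2) \<le> 9\<^sup>2" for n
    proof (intro AE_I2)
      fix x
      have "cmod (of_real (?f x) - s n x) \<le> cmod (of_real (?f x)) + cmod (s n x)"
        by (rule norm_triangle_ineq4)
      also have "\<dots> \<le> 9" using bound[of n x] by (auto simp: indicator_def)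
      finally have "(cmod (of_real (?f x) - s n x))\<^sup>2 \<le> 9\<^sup>2"
        by (rule power_mono) simp
      then show "norm ((cmod (of_real (?f x) - s n x))\<^sup>2) \<le> 9\<^sup>2"
        by (simp only: abs_power2 real_norm_def)
    qed
    have "AE x in lebesgue_on (cube L). \<forall>i. x $ i \<noteq> 0 \<and> x $ i \<noteq> L \<and> x $ i \<noteq> a $ i"
      by (simp only: AE_all_countable AE_conj_iff) (auto intro: AE_cube_nth_neq)
    moreover have "AE x in lebesgue_on (cube L). x \<in> cube L"
      by (rule AE_I2) (simp add: space_restrict_space)
    ultimately show "AE x in lebesgue_on (cube L). (\<lambda>n. (cmod (of_real (?f x) - s n x))\<^sup>2) \<longlonglongrightarrow> 0"
    proof eventually_elim
      case (elim x)
      then have "(\<lambda>n. p i n x) \<longlonglongrightarrow> (if x $ i \<le> a $ i then 1 else 0)" for i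
        by (intro p(3)) (auto simp: mem_cube order_less_le)
      then have "(\<lambda>n. s n x) \<longlonglongrightarrow> (\<Prod>i\<in>UNIV. if x $ i \<le> a $ i then 1 else 0)"
        unfolding s_def by (intro tendsto_prod)
      also have "(\<Prod>i\<in>UNIV. if x $ i \<le> a $ i then 1 else 0) = complex_of_real (?f x)"
        by (auto simp: indicator_def less_eq_vec_def)
      finally have "(\<lambda>n. (cmod (of_real (?f x) - s n x))\<^sup>2) \<longlonglongrightarrow> (cmod (of_real (?f x) - of_real (?f x)))\<^sup>2"
        by (intro tendsto_intros)
      then show ?case by simp
    qed
  qed simp
  then have lim: "(\<lambda>n. LINT x|lebesgue_on (cube L). (cmod (of_real (?f x) - s n x))\<^sup>2) \<longlonglongrightarrow> 0" by simp
  show ?thesis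
    unfolding approximable_def
  proof (intro conjI allI impI f)
    fix e :: real assume "e > 0"
    then have "\<forall>\<^sub>F n in sequentially. (LINT x|lebesgue_on (cube L). (cmod (of_real (?f x) - s n x))\<^sup>2) < e"
      using lim by (intro order_tendstoD(2)) auto
    then show "\<exists>p. trig_poly L p \<and> (LINT x|lebesgue_on (cube L). (cmod (of_real (?f x) - p x))\<^sup>2) < e"
      using s eventually_happens trivial_limit_sequentially by blast
  qed
qed

lemma approximable_sum:
  assumes "finite I" "\<And>i. i \<in> I \<Longrightarrow> approximable L (f i)"
  shows "approximable L (\<lambda>x. \<Sum>i\<in>I. f i x)"
  using assms by (induction I) (auto intro: approximable_const approximable_add)

lemma sq_integrable_indicator:
  assumes "A \<in> sets borel"
  shows "sq_integrable L (indicator A :: real^3 \<Rightarrow> real)"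
  using assms by (intro sq_integrable_bounded[where B = 1] borel_measurable_lebesgue_on_cube)
    (auto simp: indicator_def)

text \<open>Dynkin's theorem: orthants are stable under intersection and generate the Borel sets,
  while sets with approximable indicator are closed under complements and countable disjoint
  unions.\<close>

lemma approximable_indicator:
  fixes A :: "(real^3) set"
  assumes "L > 0" "A \<in> sets borel"
  shows "approximable L (indicator A)"
proof -
  let ?G = "range (\<lambda>a::real^3. {..a})"
  have "{..a} \<inter> {..b} = {..\<chi> i. min (a $ i) (b $ i)}" for a b :: "real^3"
    by (auto simp: less_eq_vec_def)
  then have "Int_stable ?G"
    by (auto simp: Int_stable_def)
  moreover have "?G \<subseteq> Pow UNIV" by simp
  moreover have "A \<in> sigma_sets UNIV ?G"
    using assms(2) by (simp add: borel_eq_atMost)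
  ultimately show ?thesis
  proof (induction rule: sigma_sets_induct_disjoint)
    case (basic A)
    then show ?case using approximable_orthant[OF assms(1)] by auto
  next
    case empty
    then show ?case using approximable_const[of L 0] by (simp add: indicator_def)
  next
    case (compl A)
    have "indicator (UNIV - A) = (\<lambda>x. 1 - indicator A x :: real)"
      by (auto simp: indicator_def)
    then show ?case using approximable_diff[OF approximable_const[of L 1] compl.IH] by simp
  next
    case (union A)
    have borel: "A i \<in> sets borel" for i
      using union.hyps(2) by (auto simp: borel_eq_atMost)
    let ?g = "\<lambda>n x. \<Sum>i<n. indicator (A i) x :: real"
    have eq: "?g n x = indicator (\<Union>i<n. A i) x" for n x
      using union.hyps(1) by (subst indicator_UN_disjoint) (auto simp: disjoint_family_on_def)
    show ?case
    proof (rule approximable_dominated_limit[where g = ?g])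
      show "approximable L (?g n)" for n
        by (intro approximable_sum union.IH) auto
      show "sq_integrable L (indicator (\<Union>i. A i) :: real^3 \<Rightarrow> real)"
        by (intro sq_integrable_indicator sets.countable_UN) (use borel in auto)
      show "(\<lambda>n. ?g n x) \<longlonglongrightarrow> indicator (\<Union>i. A i) x" for x
        unfolding eq by (rule LIMSEQ_indicator_UN)
      show "\<bar>indicator (\<Union>i. A i) x - ?g n x\<bar> \<le> \<bar>indicator (\<Union>i. A i) x\<bar>" for n x
        unfolding eq by (auto simp: indicator_def)
    qed
  qed
qed

text \<open>Induction through indicators, multiples, sums and monotone limits. Square integrability
  is assumed of the final function only and passes to the pieces, since each lies between 0 and the
  whole.\<close>

lemma approximable_borel_nonneg:
  assumes "L > 0" "u \<in> borel_measurable borel" "\<And>x. 0 \<le> u x" "sq_integrable L u"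
  shows "approximable L u"
  using assms(2,3,4)
proof (induction rule: borel_measurable_induct_real)
  case (set A)
  then show ?case using approximable_indicator[OF assms(1)] by simp
next
  case (mult u c)
  show ?case
  proof (cases "c = 0")
    case True
    then show ?thesis using approximable_const[of L 0] by simp
  next
    case False
    then have "sq_integrable L u"
      using sq_integrable_scaleR[OF mult.prems, of "1 / c"] by simp
    then show ?thesis by (intro approximable_scale mult.IH)
  qed
next
  case (add u v)
  have "sq_integrable L w"
    if "w \<in> borel_measurable borel" "\<And>x. 0 \<le> w x" "\<And>x. w x \<le> v x + u x" for w
  proof (rule sq_integrable_bound)
    show "w \<in> borel_measurable (lebesgue_on (cube L))" by (intro borel_measurable_lebesgue_on_cube that)
    show "integrable (lebesgue_on (cube L)) (\<lambda>x. (norm (v x + u x))\<^sup>2)"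
      by (rule sq_integrableD[OF add.prems])
    show "(norm (w x))\<^sup>2 \<le> (norm (v x + u x))\<^sup>2" for x
      using that(2,3)[of x] by (intro power_mono) auto
  qed
  then show ?case
    using add by (intro approximable_add) auto
next
  case (seq U)
  have le: "U n x \<le> u x" for n x
    using seq.hyps(3) seq.hyps(4)[of x] by (intro incseq_le) (auto simp: incseq_def le_fun_def)
  show ?case
  proof (rule approximable_dominated_limit[where g = U])
    show "approximable L (U n)" for n
    proof (intro seq.IH sq_integrable_bound)
      show "U n \<in> borel_measurable (lebesgue_on (cube L))" by (intro borel_measurable_lebesgue_on_cube seq)
      show "integrable (lebesgue_on (cube L)) (\<lambda>x. (norm (u x))\<^sup>2)"
        by (rule sq_integrableD[OF seq.prems])
      show "(norm (U n x))\<^sup>2 \<le> (norm (u x))\<^sup>2" for x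
        using le[of n x] seq.hyps(2)[of n x] by (intro power_mono) auto
    qed
    show "\<bar>u x - U n x\<bar> \<le> \<bar>u x\<bar>" for n x
      using le[of n x] seq.hyps(2)[of n x] by auto
  qed (use seq in auto)
qed

text \<open>The induction above is over Borel functions, whereas \<open>f\<close> is Lebesgue
  measurable on the cube. Extended by 0 and changed on a null set it becomes a Borel function at L2
  distance 0.\<close>

lemma approximable_sq_integrable:
  assumes "L > 0" "sq_integrable L f"
  shows "approximable L f"
proof -
  have "(\<lambda>x. if x \<in> cube L then f x else 0) \<in> borel_measurable lebesgue"
    using assms(2) by (intro borel_measurable_if_I) (auto simp: sq_integrable_def)
  then obtain g where g: "g \<in> borel_measurable borel" "AE x in lborel. (if x \<in> cube L then f x else 0) = g x"
    using completion_ex_borel_measurable_real[of _ lborel] by auto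
  have "AE x in lebesgue. (if x \<in> cube L then f x else 0) = g x"
    using g(2) by (rule AE_completion)
  then have AE: "AE x in lebesgue_on (cube L). f x = g x"
    by (subst AE_restrict_space_iff) (auto elim: eventually_mono)
  have gm: "g \<in> borel_measurable (lebesgue_on (cube L))"
    by (intro borel_measurable_lebesgue_on_cube g)
  have sg: "sq_integrable L g"
    unfolding sq_integrable_def
  proof (intro conjI gm)
    show "integrable (lebesgue_on (cube L)) (\<lambda>x. (norm (g x))\<^sup>2)"
      by (rule integrable_cong_AE_imp[OF sq_integrableD[OF assms(2)]]) (use gm AE in auto)
  qed
  \<comment> \<open>The values 1 and -1 of \<open>c\<close> give the positive and the negative
    part.\<close>
  have part: "approximable L (\<lambda>x. max 0 (c * g x))" if "\<bar>c\<bar> = 1" for c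
  proof (rule approximable_borel_nonneg[OF assms(1)])
    show m: "(\<lambda>x. max 0 (c * g x)) \<in> borel_measurable borel" using g(1) by measurable
    show "sq_integrable L (\<lambda>x. max 0 (c * g x))"
    proof (rule sq_integrable_bound[OF borel_measurable_lebesgue_on_cube[OF m] sq_integrableD[OF sg]])
      show "(norm (max 0 (c * g x)))\<^sup>2 \<le> (norm (g x))\<^sup>2" for x
        using that by (intro power_mono) (auto simp: abs_if split: if_splits)
    qed
  qed simp
  have "approximable L (\<lambda>x. max 0 (1 * g x) - max 0 (- 1 * g x))"
    by (intro approximable_diff part) auto
  also have "(\<lambda>x. max 0 (1 * g x) - max 0 (- 1 * g x)) = g" by auto
  finally have "approximable L g" .
  show ?thesis
  proof (rule approximable_trans[OF assms(2)])
    fix e :: real assume "e > 0"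
    have "(LINT x|lebesgue_on (cube L). (f x - g x)\<^sup>2) = (LINT x|lebesgue_on (cube L). (0::real))"
      by (rule integral_cong_AE) (use AE gm assms(2) in \<open>auto simp: sq_integrable_def\<close>)
    with \<open>e > 0\<close> \<open>approximable L g\<close>
    show "\<exists>g. approximable L g \<and> (LINT x|lebesgue_on (cube L). (f x - g x)\<^sup>2) < e" by auto
  qed
qed

lemma parseval:
  assumes "L > 0" "sq_integrable L f"
  shows "((\<lambda>k. (cmod (fourier L (\<lambda>x. of_real (f x)) k))\<^sup>2) has_sum
    L^3 * (LINT x|lebesgue_on (cube L). (f x)\<^sup>2)) UNIV"
proof -
  have "\<exists>F a. finite F \<and>
      (LINT x|lebesgue_on (cube L). (cmod (of_real (f x) - (\<Sum>k\<in>F. a k * wave L k x)))\<^sup>2) < e" if e: "e > 0" for e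
  proof -
    obtain p where "trig_poly L p" "(LINT x|lebesgue_on (cube L). (cmod (of_real (f x) - p x))\<^sup>2) < e"
      using approximable_sq_integrable[OF assms] e unfolding approximable_def by blast
    with trig_poly_eq_sum[of L p] show ?thesis by auto
  qed
  from parseval_of_approximable[OF assms(1) sq_integrable_of_real[OF assms(2)] this]
  show ?thesis by simp
qed

section \<open>Modes of vector fields\<close>

definition mode :: "real \<Rightarrow> int^3 \<Rightarrow> real \<Rightarrow> real^3 \<Rightarrow> vfield" where
  "mode L k \<alpha> a = (\<lambda>x. cos (freq L k \<bullet> x + \<alpha>) *\<^sub>R a)"

lemma mode_has_derivative:
  "(mode L k \<alpha> a has_derivative (\<lambda>h. (- sin (freq L k \<bullet> x + \<alpha>) * (freq L k \<bullet> h)) *\<^sub>R a)) (at x)"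
  unfolding mode_def by (auto intro!: derivative_eq_intros)

lemma partial_deriv_mode:
  "partial_deriv j (mode L k \<alpha> a) = mode L k (\<alpha> + pi / 2) (freq L k $ j *\<^sub>R a)"
  unfolding partial_deriv_def frechet_derivative_at[OF mode_has_derivative, symmetric]
  by (simp add: mode_def inner_axis cos_add sin_add fun_eq_iff algebra_simps)

text \<open>Differentiation only shifts the phase and rescales the amplitude, so the induction must
  leave both arbitrary.\<close>

lemma C_k_mode: "C_k n (mode L k \<alpha> a)"
proof (induction n arbitrary: \<alpha> a)
  case 0
  show ?case by (auto simp: mode_def intro!: continuous_intros)
next
  case (Suc n)
  then show ?case
    unfolding C_k.simps partial_deriv_mode differentiable_def using mode_has_derivative by blast
qed

lemma mode_periodic_test:
  assumes "L \<noteq> 0"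
  shows "mode L k \<alpha> a \<in> periodic_tests L"
proof -
  have "cos (freq L k \<bullet> (x + L *\<^sub>R axis i 1) + \<alpha>) = cos (freq L k \<bullet> x + \<alpha>)" for x i
  proof -
    have "freq L k \<bullet> (x + L *\<^sub>R axis i 1) + \<alpha> = (freq L k \<bullet> x + \<alpha>) + 2 * pi * of_int (k $ i)"
      using assms by (simp add: inner_add_right inner_axis freq_def)
    then show ?thesis 
      by (simp only: cos_add[of _ "2 * pi * of_int (k $ i)"] cos_int_2pin sin_int_2pin mult_1_right mult_zero_right diff_zero)
  qed
  then show ?thesis
    by (auto simp: periodic_tests_def smooth_def C_k_mode) (simp add: mode_def)
qed

lemma classical_curl_mode:
  "classical_curl (mode L k \<alpha> a) = mode L k (\<alpha> + pi / 2) (cross3 (freq L k) a)"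
  unfolding classical_curl_def partial_deriv_mode
  by (simp add: fun_eq_iff mode_def cross3_simps forall_3)

text \<open>The vector that represents the pairing with \<open>mode L k \<alpha> a\<close> as a
  linear function of the amplitude \<open>a\<close>.\<close>

definition mode_coeff :: "real \<Rightarrow> vfield \<Rightarrow> int^3 \<Rightarrow> real \<Rightarrow> real^3" where
  "mode_coeff L v k \<alpha> = (LINT x|lebesgue_on (cube L). cos (freq L k \<bullet> x + \<alpha>) *\<^sub>R v x)"

text \<open>\<open>sq_integrable\<close> allows every Euclidean codomain, so that one set of lemmas
  covers fields, their real components and complex waves.\<close>

lemma L2_field_iff_sq_integrable: "L2_field L v \<longleftrightarrow> sq_integrable L v"
  by (simp add: L2_field_def sq_integrable_def)

lemma sq_integrable_mode: "sq_integrable L (mode L k \<alpha> a)"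
proof (rule sq_integrable_bounded)
  show "mode L k \<alpha> a \<in> borel_measurable (lebesgue_on (cube L))"
    unfolding mode_def by (intro continuous_measurable_cube continuous_intros)
  show "norm (mode L k \<alpha> a x) \<le> norm a" for x
    by (simp add: mode_def mult_left_le_one_le)
qed

lemma integrable_mode_coeff:
  assumes "L2_field L v"
  shows "integrable (lebesgue_on (cube L)) (\<lambda>x. cos (freq L k \<bullet> x + \<alpha>) *\<^sub>R v x)"
proof (rule Bochner_Integration.integrable_bound)
  interpret finite_measure "lebesgue_on (cube L)" by (rule finite_measure_cube)
  have v: "sq_integrable L v" using assms by (simp add: L2_field_iff_sq_integrable)
  show "integrable (lebesgue_on (cube L)) (\<lambda>x. (norm (v x))\<^sup>2 + 1)"
    using sq_integrableD[OF v] by simp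
  have "(\<lambda>x. cos (freq L k \<bullet> x + \<alpha>)) \<in> borel_measurable (lebesgue_on (cube L))"
    by (intro continuous_measurable_cube continuous_intros)
  then show "(\<lambda>x. cos (freq L k \<bullet> x + \<alpha>) *\<^sub>R v x) \<in> borel_measurable (lebesgue_on (cube L))"
    using v by measurable
  have "norm (cos (freq L k \<bullet> x + \<alpha>) *\<^sub>R v x) \<le> (norm (v x))\<^sup>2 + 1" for x
  proof -
    have "norm (cos (freq L k \<bullet> x + \<alpha>) *\<^sub>R v x) \<le> norm (v x)"
      by (simp add: mult_left_le_one_le)
    also have "\<dots> \<le> (norm (v x))\<^sup>2 + 1"
      using mult_le_sum_squares[of "v x" "1::real"] by simp
    finally show ?thesis .
  qed
  then show "AE x in lebesgue_on (cube L). norm (cos (freq L k \<bullet> x + \<alpha>) *\<^sub>R v x) \<le> norm ((norm (v x))\<^sup>2 + 1)"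
    by (intro AE_I2) simp
qed

lemma L2_inner_mode:
  assumes "L2_field L v"
  shows "L2_inner L v (mode L k \<alpha> a) = mode_coeff L v k \<alpha> \<bullet> a"
  unfolding L2_inner_def mode_coeff_def mode_def
  by (subst integral_inner_left[symmetric, OF integrable_mode_coeff[OF assms]]) (simp add: inner_commute)

lemma mode_coeff_add:
  assumes "L2_field L u" "L2_field L v"
  shows "mode_coeff L (\<lambda>x. u x + v x) k \<alpha> = mode_coeff L u k \<alpha> + mode_coeff L v k \<alpha>"
  unfolding mode_coeff_def using assms
  by (simp add: scaleR_add_right integrable_mode_coeff)

lemma mode_coeff_pi: "mode_coeff L v k (\<alpha> + pi) = - mode_coeff L v k \<alpha>"
  unfolding mode_coeff_def by (simp add: add.assoc[symmetric])

text \<open>The phases 0 and pi/2 yield the integrals against the cosine and minus the sine, which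
  are the real and imaginary parts of the complex Fourier coefficients of the components.\<close>

definition mode_energy :: "real \<Rightarrow> vfield \<Rightarrow> int^3 \<Rightarrow> real" where
  "mode_energy L v k = (norm (mode_coeff L v k 0))\<^sup>2 + (norm (mode_coeff L v k (pi / 2)))\<^sup>2"

lemma sq_integrable_nth:
  fixes v :: "real^3 \<Rightarrow> real^'n"
  assumes "sq_integrable L v"
  shows "sq_integrable L (\<lambda>x. v x $ i)"
proof (rule sq_integrable_bound[OF _ sq_integrableD[OF assms]])
  show "(\<lambda>x. v x $ i) \<in> borel_measurable (lebesgue_on (cube L))"
    using borel_measurable_inner[OF sq_integrable_measurable[OF assms] borel_measurable_const[of "axis i 1"]]
    by (simp add: inner_axis)
  show "(norm (v x $ i))\<^sup>2 \<le> (norm (v x))\<^sup>2" for x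
    by (intro power_mono Finite_Cartesian_Product.norm_nth_le) auto
qed

lemma cmod_fourier_component:
  assumes "L2_field L v"
  shows "(cmod (fourier L (\<lambda>x. of_real (v x $ i)) k))\<^sup>2
    = (mode_coeff L v k 0 $ i)\<^sup>2 + (mode_coeff L v k (pi / 2) $ i)\<^sup>2"
proof -
  have v: "sq_integrable L v" using assms by (simp add: L2_field_iff_sq_integrable)
  have vi: "sq_integrable L (\<lambda>x. v x $ i)" by (rule sq_integrable_nth[OF v])
  have int: "integrable (lebesgue_on (cube L)) (\<lambda>x. of_real (v x $ i) * wave L (- k) x)"
    using integrable_mult_sq_integrable[OF sq_integrable_of_real[OF vi] sq_integrable_wave[of L 1]] by simp
  have coeff: "mode_coeff L v k \<alpha> $ i = (LINT x|lebesgue_on (cube L). cos (freq L k \<bullet> x + \<alpha>) * v x $ i)" for \<alpha>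
    using integral_inner_left[of "axis i 1", OF integrable_mode_coeff[OF assms, of k \<alpha>]]
    by (simp add: mode_coeff_def inner_axis)
  have "Re (fourier L (\<lambda>x. of_real (v x $ i)) k) = mode_coeff L v k 0 $ i"
    unfolding fourier_def coeff
    by (subst integral_Re[symmetric, OF int]) (simp add: wave_def freq_minus mult.commute)
  moreover have "Im (fourier L (\<lambda>x. of_real (v x $ i)) k) = mode_coeff L v k (pi / 2) $ i"
    unfolding fourier_def coeff
    by (subst integral_Im[symmetric, OF int]) (simp add: wave_def freq_minus mult.commute cos_add)
  ultimately show ?thesis by (simp add: cmod_power2)
qed

lemma L2_norm_square:
  "(L2_norm L v)\<^sup>2 = (LINT x|lebesgue_on (cube L). (norm (v x))\<^sup>2)"
  unfolding L2_norm_def L2_inner_def by (simp add: dot_square_norm)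

lemma parseval_field:
  assumes "L > 0" "L2_field L v"
  shows "(mode_energy L v has_sum L^3 * (L2_norm L v)\<^sup>2) UNIV"
proof -
  have v: "sq_integrable L v" using assms by (simp add: L2_field_iff_sq_integrable)
  let ?I = "\<lambda>i. LINT x|lebesgue_on (cube L). (v x $ i)\<^sup>2"
  let ?c = "\<lambda>i k. (mode_coeff L v k 0 $ i)\<^sup>2 + (mode_coeff L v k (pi / 2) $ i)\<^sup>2"
  have "(?c i has_sum L^3 * ?I i) UNIV" for i
    using parseval[OF assms(1) sq_integrable_nth[OF v, of i]] cmod_fourier_component[OF assms(2)] by simp
  then have "((\<lambda>k. ?c 1 k + ?c 2 k + ?c 3 k) has_sum L^3 * ?I 1 + L^3 * ?I 2 + L^3 * ?I 3) UNIV"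
    by (intro has_sum_add) auto
  also have "(\<lambda>k. ?c 1 k + ?c 2 k + ?c 3 k) = mode_energy L v"
    by (simp add: fun_eq_iff mode_energy_def power2_norm_eq_inner inner_vec_def sum_3 flip: power2_eq_square)
  also have "L^3 * ?I 1 + L^3 * ?I 2 + L^3 * ?I 3 = L^3 * (L2_norm L v)\<^sup>2"
  proof -
    have "integrable (lebesgue_on (cube L)) (\<lambda>x. (v x $ i)\<^sup>2)" for i
      using sq_integrableD[OF sq_integrable_nth[OF v, of i]] by simp
    then have "(LINT x|lebesgue_on (cube L). (norm (v x))\<^sup>2) = ?I 1 + ?I 2 + ?I 3"
      by (simp add: power2_norm_eq_inner inner_vec_def sum_3 flip: power2_eq_square)
    then show ?thesis by (simp add: L2_norm_square distrib_left)
  qed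
  finally show ?thesis .
qed

section \<open>Evolution of the modes\<close>

text \<open>A weakened Cauchy-Schwarz inequality, enough for continuity of the pairing in
  \<open>u\<close>. The added 1 spares the case of a vanishing \<open>v\<close>: the choice
  \<open>r = b / (c + 1)\<close> is always defined.\<close>

lemma L2_inner_square_le:
  assumes "L2_field L u" "L2_field L v"
  shows "(L2_inner L u v)\<^sup>2 \<le> (L2_norm L u)\<^sup>2 * ((L2_norm L v)\<^sup>2 + 1)"
proof -
  define a b c where "a = (L2_norm L u)\<^sup>2" and "b = L2_inner L u v" and "c = (L2_norm L v)\<^sup>2"
  have u: "sq_integrable L u" and v: "sq_integrable L v"
    using assms by (simp_all add: L2_field_iff_sq_integrable)
  have c: "c \<ge> 0" by (simp add: c_def)
  define r where "r = b / (c + 1)"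
  have "0 \<le> (LINT x|lebesgue_on (cube L). (norm (u x - r *\<^sub>R v x))\<^sup>2)" by simp
  also have "\<dots> = (LINT x|lebesgue_on (cube L). (norm (u x))\<^sup>2 - 2 * r * (u x \<bullet> v x) + r * r * (norm (v x))\<^sup>2)"
    by (intro Bochner_Integration.integral_cong refl)
      (simp add: power2_norm_eq_inner inner_diff_left inner_diff_right inner_commute algebra_simps)
  also have "\<dots> = a - 2 * r * b + r\<^sup>2 * c"
    using integrable_inner_sq_integrable[OF u v] sq_integrableD[OF u] sq_integrableD[OF v]
    by (simp add: a_def b_def c_def L2_norm_square L2_inner_def power2_eq_square[of r])
  also have "\<dots> \<le> a - 2 * r * b + r\<^sup>2 * (c + 1)" by (simp add: algebra_simps)
  also have "\<dots> = a - b\<^sup>2 / (c + 1)"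
    using c by (simp add: r_def power2_eq_square divide_simps)
  finally have "b\<^sup>2 / (c + 1) \<le> a" by simp
  moreover have "c + 1 > 0" using c by linarith
  ultimately have "b\<^sup>2 \<le> a * (c + 1)" by (simp only: pos_divide_le_eq)
  then show ?thesis by (simp only: a_def b_def c_def)
qed

lemma L2_field_diff: "L2_field L u \<Longrightarrow> L2_field L v \<Longrightarrow> L2_field L (\<lambda>x. u x - v x)"
  by (simp add: L2_field_iff_sq_integrable sq_integrable_diff)

lemma L2_field_add: "L2_field L u \<Longrightarrow> L2_field L v \<Longrightarrow> L2_field L (\<lambda>x. u x + v x)"
  by (simp add: L2_field_iff_sq_integrable sq_integrable_add)

lemma L2_field_scaleR: "L2_field L u \<Longrightarrow> L2_field L (\<lambda>x. c *\<^sub>R u x)"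
  by (simp add: L2_field_iff_sq_integrable sq_integrable_scaleR)

lemma L2_inner_diff_left:
  assumes "L2_field L u" "L2_field L v" "L2_field L w"
  shows "L2_inner L (\<lambda>x. u x - v x) w = L2_inner L u w - L2_inner L v w"
  using assms unfolding L2_inner_def inner_diff_left
  by (simp add: L2_field_iff_sq_integrable integrable_inner_sq_integrable)

lemma L2_inner_scaleR_left: "L2_inner L (\<lambda>x. c *\<^sub>R u x) w = c * L2_inner L u w"
  unfolding L2_inner_def by simp

lemma L2_norm_le_H_curl_norm: "L2_norm L v \<le> H_curl_norm L v"
  unfolding H_curl_norm_def by (rule real_le_rsqrt) simp

lemma L2_norm_nonneg: "0 \<le> L2_norm L v"
  unfolding L2_norm_def L2_inner_def by simp

lemma H_curl_per_L2: "v \<in> H_curl_per L \<Longrightarrow> L2_field L v"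
  by (simp add: H_curl_per_def H_curl_def)

lemma H_curl_per_curl_L2:
  assumes "v \<in> H_curl_per L"
  shows "L2_field L (curl L v)"
proof -
  have "\<exists>w. L2_field L w \<and> has_weak_curl L v w"
    using assms by (simp add: H_curl_per_def H_curl_def)
  from someI_ex[OF this] show ?thesis by (simp add: curl_def)
qed

text \<open>This is where the boundary condition enters: the weak curl alone allows only test fields
  supported inside the cube, which modes are not.\<close>

lemma L2_inner_curl_periodic:
  assumes "v \<in> H_curl_per L" "\<phi> \<in> periodic_tests L"
  shows "L2_inner L (curl L v) \<phi> = L2_inner L v (classical_curl \<phi>)"
  using assms by (simp add: H_curl_per_def tangential_trace_def)

lemma inner_cross3_right: "x \<bullet> cross3 k a = cross3 x k \<bullet> a"
  by (simp add: cross3_simps)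

text \<open>The curl is moved onto the mode, and the cyclic symmetry of the triple product frees the
  arbitrary amplitude again.\<close>

lemma mode_coeff_curl:
  assumes "L > 0" "v \<in> H_curl_per L"
  shows "mode_coeff L (curl L v) k \<alpha> = cross3 (mode_coeff L v k (\<alpha> + pi / 2)) (freq L k)"
proof (rule vector_eq_ldot[THEN iffD1], rule allI)
  fix a
  have "mode_coeff L (curl L v) k \<alpha> \<bullet> a = L2_inner L v (classical_curl (mode L k \<alpha> a))"
    using assms by (simp add: L2_inner_curl_periodic mode_periodic_test H_curl_per_curl_L2 flip: L2_inner_mode)
  also have "\<dots> = mode_coeff L v k (\<alpha> + pi / 2) \<bullet> cross3 (freq L k) a"
    using assms by (simp add: classical_curl_mode L2_inner_mode H_curl_per_L2)
  finally show "a \<bullet> mode_coeff L (curl L v) k \<alpha> = a \<bullet> cross3 (mode_coeff L v k (\<alpha> + pi / 2)) (freq L k)"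
    by (simp add: inner_cross3_right inner_commute)
qed

text \<open>In finite dimensions differentiability in each fixed direction suffices; this turns
  scalar weak derivatives into a vector equation.\<close>

lemma has_vector_derivative_mode_coeff:
  assumes "\<And>a. ((\<lambda>s. mode_coeff L (u s) k \<alpha> \<bullet> a) has_real_derivative d \<bullet> a) (at t)"
  shows "((\<lambda>s. mode_coeff L (u s) k \<alpha>) has_vector_derivative d) (at t)"
  using assms unfolding has_vector_derivative_def has_field_derivative_def
  by (subst has_derivative_componentwise_within) (simp add: mult_commute_abs)

lemma eventually_at_mem_interval:
  assumes "t \<in> {0<..<T::real}"
  shows "\<forall>\<^sub>F s in at t. s \<in> {0<..<T}"
  using assms eventually_at_in_open'[of "{0<..<T}" t] by simp

text \<open>The norm of H(curl) dominates the L2 norm, and pairing with a fixed mode is continuous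
  in the latter.\<close>

lemma C1_H_curl_per_mode_coeff:
  assumes "L > 0" "C1_H_curl_per L T u ut" "t \<in> {0<..<T}"
  shows "((\<lambda>s. mode_coeff L (u s) k \<alpha>) has_vector_derivative mode_coeff L (ut t) k \<alpha>) (at t)"
proof (rule has_vector_derivative_mode_coeff)
  fix a
  have mem: "u s \<in> H_curl_per L" "ut s \<in> H_curl_per L" if "s \<in> {0<..<T}" for s
    using assms(2) that by (auto simp: C1_H_curl_per_def)
  note L2 = mem[THEN H_curl_per_L2]
  let ?w = "\<lambda>s x. (u s x - u t x) /\<^sub>R (s - t) - ut t x"
  let ?\<phi> = "mode L k \<alpha> a"
  have \<phi>: "L2_field L ?\<phi>" by (simp add: L2_field_iff_sq_integrable sq_integrable_mode)
  have lim: "(\<lambda>s. H_curl_norm L (?w s)) \<midarrow>t\<rightarrow> 0"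
    using assms(2,3) by (auto simp: C1_H_curl_per_def)
  have norm: "(\<lambda>s. L2_norm L (?w s)) \<midarrow>t\<rightarrow> 0"
    by (rule tendsto_sandwich[OF _ _ tendsto_const lim])
      (auto simp: L2_norm_le_H_curl_norm L2_norm_nonneg)
  \<comment> \<open>For s in the interval this is the pairing of the error \<open>?w s\<close> of
    the difference quotient with the mode.\<close>
  let ?g = "\<lambda>s. (mode_coeff L (u s) k \<alpha> \<bullet> a - mode_coeff L (u t) k \<alpha> \<bullet> a) / (s - t) - mode_coeff L (ut t) k \<alpha> \<bullet> a"
  have "(?g s)\<^sup>2 \<le> (L2_norm L (?w s))\<^sup>2 * ((L2_norm L ?\<phi>)\<^sup>2 + 1)" if s: "s \<in> {0<..<T}" for s
  proof -
    have f: "L2_field L (\<lambda>x. (u s x - u t x) /\<^sub>R (s - t))"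
      by (intro L2_field_scaleR L2_field_diff L2 s assms)
    have "?g s = L2_inner L (?w s) ?\<phi>"
      using L2(1)[OF s] L2[OF assms(3)] f \<phi>
      by (simp add: L2_inner_diff_left L2_inner_scaleR_left L2_inner_mode divide_inverse_commute)
    then show ?thesis
      using L2_inner_square_le[OF L2_field_diff[OF f L2(2)[OF assms(3)]] \<phi>] by simp
  qed
  then have "\<forall>\<^sub>F s in at t. (?g s)\<^sup>2 \<le> (L2_norm L (?w s))\<^sup>2 * ((L2_norm L ?\<phi>)\<^sup>2 + 1)"
    using eventually_at_mem_interval[OF assms(3)] by (auto elim: eventually_mono)
  moreover have "(\<lambda>s. (L2_norm L (?w s))\<^sup>2 * ((L2_norm L ?\<phi>)\<^sup>2 + 1)) \<midarrow>t\<rightarrow> 0"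
    by (rule tendsto_eq_intros norm refl | simp)+
  ultimately have "(\<lambda>s. (?g s)\<^sup>2) \<midarrow>t\<rightarrow> 0"
    by (rule_tac tendsto_sandwich[OF _ _ tendsto_const]) auto
  then have "?g \<midarrow>t\<rightarrow> 0"
    using tendsto_real_sqrt by (fastforce simp: tendsto_rabs_zero_iff)
  then show "((\<lambda>s. mode_coeff L (u s) k \<alpha> \<bullet> a) has_real_derivative mode_coeff L (ut t) k \<alpha> \<bullet> a) (at t)"
    unfolding has_field_derivative_iff using LIM_zero_iff by blast
qed


text \<open>The two phases \<open>0\<close> and \<open>\<pi>/2\<close> are exchanged by the curl, and the exchange terms cancel because
  \<open>u \<bullet> (v \<times> k) + v \<bullet> (u \<times> k) = 0\<close>.\<close>

lemma mode_balance:
  fixes x0 x1 a0 a1 k l0 l1 :: "real^3"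
  assumes "c \<noteq> 0" "p \<noteq> 0"
  shows "1 / c\<^sup>2 * (2 * (x0 \<bullet> (- c\<^sup>2 *\<^sub>R cross3 a1 k - w\<^sup>2 *\<^sub>R e0)) + 2 * (x1 \<bullet> (- c\<^sup>2 *\<^sub>R cross3 (- a0) k - w\<^sup>2 *\<^sub>R e1)))
    + 1 / p\<^sup>2 * (2 * (l0 \<bullet> (- p\<^sup>2 *\<^sub>R a0)) + 2 * (l1 \<bullet> (- p\<^sup>2 *\<^sub>R a1)))
    + w\<^sup>2 / c\<^sup>2 * (2 * (e0 \<bullet> x0) + 2 * (e1 \<bullet> x1))
    + (2 * (a0 \<bullet> (cross3 x1 k + l0)) + 2 * (a1 \<bullet> (cross3 (- x0) k + l1))) = 0"
proof -
  have swap: "v \<bullet> cross3 u k = - (u \<bullet> cross3 v k)" for u v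
    by (simp add: cross3_simps)
  have "1 / c\<^sup>2 * (2 * (x0 \<bullet> (- c\<^sup>2 *\<^sub>R cross3 a1 k - w\<^sup>2 *\<^sub>R e0)) + 2 * (x1 \<bullet> (- c\<^sup>2 *\<^sub>R cross3 (- a0) k - w\<^sup>2 *\<^sub>R e1)))
    = - 2 * (x0 \<bullet> cross3 a1 k) + 2 * (x1 \<bullet> cross3 a0 k) - w\<^sup>2 / c\<^sup>2 * (2 * (e0 \<bullet> x0) + 2 * (e1 \<bullet> x1))"
    using assms by (simp add: inner_diff_right inner_commute field_simps)
  moreover have "1 / p\<^sup>2 * (2 * (l0 \<bullet> (- p\<^sup>2 *\<^sub>R a0)) + 2 * (l1 \<bullet> (- p\<^sup>2 *\<^sub>R a1))) = - 2 * (a0 \<bullet> l0) - 2 * (a1 \<bullet> l1)"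
    using assms by (simp add: inner_commute field_simps)
  moreover have "2 * (a0 \<bullet> (cross3 x1 k + l0)) + 2 * (a1 \<bullet> (cross3 (- x0) k + l1))
    = - 2 * (x1 \<bullet> cross3 a0 k) + 2 * (x0 \<bullet> cross3 a1 k) + 2 * (a0 \<bullet> l0) + 2 * (a1 \<bullet> l1)"
    using swap[of a0 x1] swap[of a1 x0] by (simp add: inner_add_right inner_diff_right)
  ultimately show ?thesis by simp
qed

section \<open>Conservation of the energy of each mode\<close>

lemma has_real_derivative_norm_square:
  fixes f :: "real \<Rightarrow> 'a::real_inner"
  assumes "(f has_vector_derivative f') (at t)"
  shows "((\<lambda>s. (norm (f s))\<^sup>2) has_real_derivative 2 * (f t \<bullet> f')) (at t)"
  using assms unfolding power2_norm_eq_inner has_field_derivative_def has_vector_derivative_def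
  by (auto intro!: derivative_eq_intros simp: inner_commute algebra_simps)

text \<open>Carries neither the factor 1/2 nor the volume, so the modes add up to
  \<open>2 * L^3\<close> times the energy.\<close>

definition EK_mode_energy where
  "EK_mode_energy L c \<omega>pe \<omega>pm E Et K Kt k t =
     1 / c\<^sup>2 * mode_energy L (Et t) k + 1 / \<omega>pm\<^sup>2 * mode_energy L (Kt t) k
     + \<omega>pe\<^sup>2 / c\<^sup>2 * mode_energy L (E t) k + mode_energy L (\<lambda>x. curl L (E t) x + K t x) k"

context
  fixes L T c \<omega>pe \<omega>pm :: real and E Et K Kt :: "real \<Rightarrow> vfield"
  assumes L: "L > 0" and c: "c \<noteq> 0" and \<omega>pm: "\<omega>pm \<noteq> 0"
    and sol: "EK_solution L T c \<omega>pe \<omega>pm E Et K Kt"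
begin

lemma EK_solution_mem:
  assumes "t \<in> {0<..<T}"
  shows "E t \<in> H_curl_per L" "Et t \<in> H_curl_per L" "K t \<in> H_curl_per L" "Kt t \<in> H_curl_per L"
  using assms sol by (auto simp: EK_solution_def C1_H_curl_per_def)

lemma mode_coeff_curl_E_plus_K:
  assumes "t \<in> {0<..<T}"
  shows "mode_coeff L (\<lambda>x. curl L (E t) x + K t x) k \<alpha>
    = cross3 (mode_coeff L (E t) k (\<alpha> + pi / 2)) (freq L k) + mode_coeff L (K t) k \<alpha>"
  using EK_solution_mem[OF assms] L
  by (simp add: mode_coeff_add mode_coeff_curl H_curl_per_L2 H_curl_per_curl_L2)

lemma mode_coeff_E_derivative:
  assumes "t \<in> {0<..<T}"
  shows "((\<lambda>s. mode_coeff L (E s) k \<alpha>) has_vector_derivative mode_coeff L (Et t) k \<alpha>) (at t)"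
    and "((\<lambda>s. mode_coeff L (K s) k \<alpha>) has_vector_derivative mode_coeff L (Kt t) k \<alpha>) (at t)"
  using C1_H_curl_per_mode_coeff[OF L _ assms] sol by (auto simp: EK_solution_def)

text \<open>The curl itself is never differentiated in time: its coefficient is the image of a
  coefficient of \<open>E s\<close> under a fixed linear map. That formula is known for times in the
  interval, hence the passage through an open set.\<close>

lemma mode_coeff_curl_E_plus_K_derivative:
  assumes "t \<in> {0<..<T}"
  shows "((\<lambda>s. mode_coeff L (\<lambda>x. curl L (E s) x + K s x) k \<alpha>) has_vector_derivative
    cross3 (mode_coeff L (Et t) k (\<alpha> + pi / 2)) (freq L k) + mode_coeff L (Kt t) k \<alpha>) (at t)"
proof (rule has_vector_derivative_transform_within_open)
  show "((\<lambda>s. cross3 (mode_coeff L (E s) k (\<alpha> + pi / 2)) (freq L k) + mode_coeff L (K s) k \<alpha>) has_vector_derivative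
    cross3 (mode_coeff L (Et t) k (\<alpha> + pi / 2)) (freq L k) + mode_coeff L (Kt t) k \<alpha>) (at t)"
  proof (intro has_vector_derivative_add mode_coeff_E_derivative assms)
    have "bounded_linear (\<lambda>v. cross3 v (freq L k))"
      using bilinear_cross by (simp add: bilinear_def linear_conv_bounded_linear)
    from bounded_linear.has_vector_derivative[OF this mode_coeff_E_derivative(1)[OF assms]]
    show "((\<lambda>s. cross3 (mode_coeff L (E s) k (\<alpha> + pi / 2)) (freq L k)) has_vector_derivative
      cross3 (mode_coeff L (Et t) k (\<alpha> + pi / 2)) (freq L k)) (at t)" .
  qed
  show "cross3 (mode_coeff L (E s) k (\<alpha> + pi / 2)) (freq L k) + mode_coeff L (K s) k \<alpha>
      = mode_coeff L (\<lambda>x. curl L (E s) x + K s x) k \<alpha>" if "s \<in> {0<..<T}" for s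
    using mode_coeff_curl_E_plus_K[OF that] by simp
qed (use assms in auto)

text \<open>With A = curl E + K the system formally reads Ett = -c^2 curl A - \<omega>pe^2 E and Ktt
  = -\<omega>pm^2 A. The curl of A need not exist as a field, since it falls on the mode.\<close>

lemma mode_coeff_Et_derivative:
  assumes t: "t \<in> {0<..<T}"
  shows "((\<lambda>s. mode_coeff L (Et s) k \<alpha>) has_vector_derivative
      - c\<^sup>2 *\<^sub>R cross3 (mode_coeff L (\<lambda>x. curl L (E t) x + K t x) k (\<alpha> + pi / 2)) (freq L k)
      - \<omega>pe\<^sup>2 *\<^sub>R mode_coeff L (E t) k \<alpha>) (at t)"
    and "((\<lambda>s. mode_coeff L (Kt s) k \<alpha>) has_vector_derivative
      - \<omega>pm\<^sup>2 *\<^sub>R mode_coeff L (\<lambda>x. curl L (E t) x + K t x) k \<alpha>) (at t)"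
proof -
  note mem = EK_solution_mem[THEN H_curl_per_L2]
  have per: "mode L k \<beta> a \<in> periodic_tests L" for \<beta> a
    using L by (intro mode_periodic_test) auto
  obtain Ett Ktt where Ett: "has_distr_derivative L (\<lambda>s. distr_of L (Et s)) Ett t"
    and Ktt: "has_distr_derivative L (\<lambda>s. distr_of L (Kt s)) Ktt t"
    and eqE: "\<And>\<phi>. \<phi> \<in> periodic_tests L \<Longrightarrow>
           Ett \<phi> + c\<^sup>2 * distr_curl (distr_curl (distr_of L (E t))) \<phi> + \<omega>pe\<^sup>2 * distr_of L (E t) \<phi>
             = - c\<^sup>2 * distr_curl (distr_of L (K t)) \<phi>"
    and eqK: "\<And>\<phi>. \<phi> \<in> periodic_tests L \<Longrightarrow>
           Ktt \<phi> + \<omega>pm\<^sup>2 * distr_of L (K t) \<phi> = - \<omega>pm\<^sup>2 * distr_curl (distr_of L (E t)) \<phi>"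
    using sol t unfolding EK_solution_def by blast
  \<comment> \<open>The hypothesis differentiates the pairing with a mode. It is replaced by the
    coefficient near \<open>t\<close>, where the field is known to be in L2.\<close>
  have deriv: "((\<lambda>s. mode_coeff L (u s) k \<alpha> \<bullet> a) has_real_derivative F (mode L k \<alpha> a)) (at t)"
    if "has_distr_derivative L (\<lambda>s. distr_of L (u s)) F t" "\<And>s. s \<in> {0<..<T} \<Longrightarrow> L2_field L (u s)" for u F a
  proof (rule DERIV_cong_ev[THEN iffD1, rotated -1])
    show "((\<lambda>s. L2_inner L (u s) (mode L k \<alpha> a)) has_real_derivative F (mode L k \<alpha> a)) (at t)"
      using that(1) per by (auto simp: has_distr_derivative_def distr_of_def)
    show "\<forall>\<^sub>F s in nhds t. L2_inner L (u s) (mode L k \<alpha> a) = mode_coeff L (u s) k \<alpha> \<bullet> a"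
      using eventually_nhds_in_open[of "{0<..<T}" t] t that(2)
      by (auto elim!: eventually_mono simp: L2_inner_mode)
  qed auto
  \<comment> \<open>The curl in \<open>?A\<close> adds a second quarter turn to the phase, which
    makes a half turn.\<close>
  have shift: "mode_coeff L (E t) k (\<alpha> + pi / 2 + pi / 2) = - mode_coeff L (E t) k \<alpha>"
    using mode_coeff_pi[of L "E t" k \<alpha>] by (simp add: add.assoc)
  show "((\<lambda>s. mode_coeff L (Et s) k \<alpha>) has_vector_derivative
      - c\<^sup>2 *\<^sub>R cross3 (mode_coeff L (\<lambda>x. curl L (E t) x + K t x) k (\<alpha> + pi / 2)) (freq L k)
      - \<omega>pe\<^sup>2 *\<^sub>R mode_coeff L (E t) k \<alpha>) (at t)"
  proof (rule has_vector_derivative_mode_coeff)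
    fix a
    let ?A = "mode_coeff L (\<lambda>x. curl L (E t) x + K t x) k (\<alpha> + pi / 2)"
    have A: "?A = - cross3 (mode_coeff L (E t) k \<alpha>) (freq L k) + mode_coeff L (K t) k (\<alpha> + pi / 2)"
      unfolding mode_coeff_curl_E_plus_K[OF t] shift by simp
    have "Ett (mode L k \<alpha> a)
        = - c\<^sup>2 * L2_inner L (E t) (mode L k (\<alpha> + pi / 2 + pi / 2) (cross3 (freq L k) (cross3 (freq L k) a)))
          - \<omega>pe\<^sup>2 * L2_inner L (E t) (mode L k \<alpha> a)
          - c\<^sup>2 * L2_inner L (K t) (mode L k (\<alpha> + pi / 2) (cross3 (freq L k) a))"
      using eqE[OF per[of \<alpha> a]] by (simp add: distr_curl_def distr_of_def classical_curl_mode)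
    also have "\<dots> = - c\<^sup>2 * (?A \<bullet> cross3 (freq L k) a) - \<omega>pe\<^sup>2 * (mode_coeff L (E t) k \<alpha> \<bullet> a)"
      unfolding L2_inner_mode[OF mem(1)[OF t]] L2_inner_mode[OF mem(3)[OF t]] shift A inner_add_left
      by (simp add: inner_cross3_right algebra_simps)
    also have "\<dots> = (- c\<^sup>2 *\<^sub>R cross3 ?A (freq L k) - \<omega>pe\<^sup>2 *\<^sub>R mode_coeff L (E t) k \<alpha>) \<bullet> a"
      by (simp add: inner_diff_left inner_cross3_right)
    finally show "((\<lambda>s. mode_coeff L (Et s) k \<alpha> \<bullet> a) has_real_derivative
        (- c\<^sup>2 *\<^sub>R cross3 ?A (freq L k) - \<omega>pe\<^sup>2 *\<^sub>R mode_coeff L (E t) k \<alpha>) \<bullet> a) (at t)"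
      using deriv[OF Ett mem(2), of a] by (simp only:)
  qed
  show "((\<lambda>s. mode_coeff L (Kt s) k \<alpha>) has_vector_derivative
      - \<omega>pm\<^sup>2 *\<^sub>R mode_coeff L (\<lambda>x. curl L (E t) x + K t x) k \<alpha>) (at t)"
  proof (rule has_vector_derivative_mode_coeff)
    fix a
    have "Ktt (mode L k \<alpha> a) = - \<omega>pm\<^sup>2 * L2_inner L (K t) (mode L k \<alpha> a)
        - \<omega>pm\<^sup>2 * L2_inner L (E t) (mode L k (\<alpha> + pi / 2) (cross3 (freq L k) a))"
      using eqK[OF per[of \<alpha> a]] by (simp add: distr_curl_def distr_of_def classical_curl_mode)
    also have "\<dots> = (- \<omega>pm\<^sup>2 *\<^sub>R mode_coeff L (\<lambda>x. curl L (E t) x + K t x) k \<alpha>) \<bullet> a"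
      unfolding L2_inner_mode[OF mem(1)[OF t]] L2_inner_mode[OF mem(3)[OF t]] mode_coeff_curl_E_plus_K[OF t]
      by (simp add: inner_cross3_right inner_add_left algebra_simps)
    finally show "((\<lambda>s. mode_coeff L (Kt s) k \<alpha> \<bullet> a) has_real_derivative
        (- \<omega>pm\<^sup>2 *\<^sub>R mode_coeff L (\<lambda>x. curl L (E t) x + K t x) k \<alpha>) \<bullet> a) (at t)"
      using deriv[OF Ktt mem(4), of a] by (simp only:)
  qed
qed

text \<open>An instance of \<open>mode_balance\<close>: x, e, l and a are the coefficients of
  \<open>Et t\<close>, \<open>E t\<close>, \<open>Kt t\<close> and curl E + K, with indices 0 and 1
  for the phases 0 and pi/2. The minus signs before \<open>a0\<close> and \<open>x0\<close> come
  from advancing the phase pi/2 to pi.\<close>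

lemma EK_mode_energy_derivative:
  assumes t: "t \<in> {0<..<T}"
  shows "(EK_mode_energy L c \<omega>pe \<omega>pm E Et K Kt k has_real_derivative 0) (at t)"
proof -
  have pi: "mode_coeff L v k (pi / 2 + pi / 2) = - mode_coeff L v k 0" for v
    using mode_coeff_pi[of L v k 0] by simp
  have energy: "((\<lambda>s. mode_energy L (u s) k) has_real_derivative
      2 * (mode_coeff L (u t) k 0 \<bullet> d 0) + 2 * (mode_coeff L (u t) k (pi / 2) \<bullet> d (pi / 2))) (at t)"
    if "\<And>\<alpha>. ((\<lambda>s. mode_coeff L (u s) k \<alpha>) has_vector_derivative d \<alpha>) (at t)" for u d
    unfolding mode_energy_def
    using DERIV_add[OF has_real_derivative_norm_square[OF that[of 0]] has_real_derivative_norm_square[OF that[of "pi / 2"]]] .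
  show ?thesis
    unfolding EK_mode_energy_def[abs_def]
    using DERIV_add[OF DERIV_add[OF DERIV_add[OF
          DERIV_cmult[OF energy[OF mode_coeff_Et_derivative(1)[OF t]], of "1 / c\<^sup>2"]
          DERIV_cmult[OF energy[OF mode_coeff_Et_derivative(2)[OF t]], of "1 / \<omega>pm\<^sup>2"]]
          DERIV_cmult[OF energy[OF mode_coeff_E_derivative(1)[OF t]], of "\<omega>pe\<^sup>2 / c\<^sup>2"]]
          energy[OF mode_coeff_curl_E_plus_K_derivative[OF t]]]
    by (simp only: pi add_0 mode_balance[OF c \<omega>pm])
qed

section \<open>Summation over all wave vectors\<close>

lemma EK_mode_energy_sum:
  assumes "t \<in> {0<..<T}"
  shows "((\<lambda>k. EK_mode_energy L c \<omega>pe \<omega>pm E Et K Kt k t) has_sum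
    2 * L^3 * energy_EK L c \<omega>pe \<omega>pm E Et K Kt t) UNIV"
proof -
  note mem = EK_solution_mem[OF assms]
  note [simp] = mem[THEN H_curl_per_L2] mem[THEN H_curl_per_curl_L2]
  let ?A = "\<lambda>x. curl L (E t) x + K t x"
  have "((\<lambda>k. EK_mode_energy L c \<omega>pe \<omega>pm E Et K Kt k t) has_sum
    1 / c\<^sup>2 * (L^3 * (L2_norm L (Et t))\<^sup>2) + 1 / \<omega>pm\<^sup>2 * (L^3 * (L2_norm L (Kt t))\<^sup>2)
     + \<omega>pe\<^sup>2 / c\<^sup>2 * (L^3 * (L2_norm L (E t))\<^sup>2) + L^3 * (L2_norm L ?A)\<^sup>2) UNIV"
    unfolding EK_mode_energy_def
    by (intro has_sum_add has_sum_cmult_right parseval_field L) (auto intro: L2_field_add)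
  then show ?thesis by (simp add: energy_EK_def algebra_simps)
qed

lemma energy_EK_derivative:
  assumes t: "t \<in> {0<..<T}"
  shows "(energy_EK L c \<omega>pe \<omega>pm E Et K Kt has_real_derivative 0) (at t)"
proof -
  let ?e = "EK_mode_energy L c \<omega>pe \<omega>pm E Et K Kt"
  have const: "?e k s = ?e k t" if s: "s \<in> {0<..<T}" for k s
  proof -
    have "\<exists>C. \<forall>r\<in>{0<..<T}. ?e k r = C"
      by (rule has_field_derivative_zero_constant)
        (auto intro!: has_field_derivative_at_within EK_mode_energy_derivative)
    with s t show ?thesis by metis
  qed
  have "energy_EK L c \<omega>pe \<omega>pm E Et K Kt s = energy_EK L c \<omega>pe \<omega>pm E Et K Kt t" if s: "s \<in> {0<..<T}" for s
  proof -
    \<comment> \<open>Both energies are sums of the same series up to the factor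
      \<open>2 * L^3\<close>, which is nonzero.\<close>
    have "((\<lambda>k. ?e k t) has_sum 2 * L^3 * energy_EK L c \<omega>pe \<omega>pm E Et K Kt s) UNIV"
      using EK_mode_energy_sum[OF s] const[OF s] by simp
    from has_sum_unique[OF this EK_mode_energy_sum[OF t]] L show ?thesis by simp
  qed
  then have "energy_EK L c \<omega>pe \<omega>pm E Et K Kt t = energy_EK L c \<omega>pe \<omega>pm E Et K Kt s" if "s \<in> {0<..<T}" for s
    using that by simp
  from has_field_derivative_transform_within_open[OF DERIV_const open_greaterThanLessThan t this]
  show ?thesis .
qed

end

theorem theorem1:
  fixes L T \<epsilon>0 \<mu>0 \<omega>pe \<omega>pm c :: real
    and E Et K Kt :: "real \<Rightarrow> vfield"
  assumes "L > 0" and "T > 0"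
    and "\<epsilon>0 > 0" and "\<mu>0 > 0" and "\<omega>pe > 0" and "\<omega>pm > 0"
    and "c = 1 / sqrt (\<epsilon>0 * \<mu>0)"
    and "EK_solution L T c \<omega>pe \<omega>pm E Et K Kt"
  shows "\<forall>t\<in>{0<..<T}. (energy_EK L c \<omega>pe \<omega>pm E Et K Kt has_real_derivative 0) (at t)"
  using assms by (auto intro!: energy_EK_derivative)

end
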